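(* Let $\mathcal{A}$ be a 1-clock parametric timed automaton and $\ell_f$ a location of $\mathcal{A}$ (its final location). Let $\hat L$ be the language of the automaton of the zones $\hat{\mathcal{A}}$, and $e$ a regular expression describing $\hat L$. Let $\bar e$ be the expression obtained by replacing the operators $.$, $+$ and $^*$ in $e$ respectively by $\bar{.}$, $\bar{+}$ and $^{\bar *}$. Then $\bar e=\mathrm{PET}(\mathcal{A})$.
   Context: Clocks and delays take values in $\mathbb{R}_{\ge 0}$; parameters in $\mathbb{P}$ take values in $\mathbb{N}$; the auxiliary parameter $d$ below stands for a duration. PTAs. A parametric timed automaton (PTA) is a tuple $(\Sigma,L,\ell_0,\ell_{priv},\ell_f,\mathbb{X},\mathbb{P},I,E)$ with finite sets $\Sigma$ of actions and $L$ of locations, initial, private and final locations in $L$, finite sets $\mathbb{X}$ of clocks and $\mathbb{P}=\{p_1,\dots,p_M\}$ of parameters, an invariant $I$ assigning a clock guard to every location, and a finite set $E$ of edges $(\ell,g,a,R,\ell')$ with $g$ a clock guard, $a\in\Sigma$, $R\subseteq\mathbb{X}$ the clocks reset to $0$. A clock guard is a conjunction of inequalities $x\bowtie\sum_i\alpha_i p_i+\gamma$ with $x\in\mathbb{X}$, $\alpha_i,\gamma\in\mathbb{Z}$, ${\bowtie}\in\{<,\le,=,\ge,>\}$. A 1-clock PTA has exactly one clock, denoted $x$. For a parameter valuation $v$, $v(\mathcal{A})$ is obtained by replacing each $p_i$ by $v(p_i)$. Its states are pairs $(\ell,\mu)$ with $\mu$ a clock valuation satisfying $v(I(\ell))$;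 the initial state is $(\ell_0,\vec 0)$. A step $(\ell,\mu)\xrightarrow{(\delta,e)}(\ell',\mu')$ with $e=(\ell,g,a,R,\ell')$ consists of a delay $\delta\ge0$ in $\ell$ (the invariant holding throughout; no time may pass if $\ell$ is urgent) followed by taking $e$ (guard satisfied, clocks in $R$ reset, resulting state satisfying the invariant of $\ell'$). A finite run starts from the initial state, $(\ell_0,\mu_0),(\delta_0,e_0),\dots,(\ell_n,\mu_n)$; its duration is $\sum_{i<n}\delta_i$. $\mathrm{PET}(\mathcal{A})$ is the set of pairs $(v,d)$ such that $v(\mathcal{A})$ has a finite run of duration $d$ with $\ell_n=\ell_f$ and $\ell_i\ne\ell_f$ for all $0\le i\le n-1$. $\mathrm{EFsynth}(\mathcal{B},T)$ is the set of all parameter valuations of $\mathcal{B}$ for which some location of $T$ is reachable. Final-reset pairs. $FrP(\mathcal{A},\ell_f)$ is the set of pairs $(\ell_i,\ell_j)$ of locations such that: $\ell_i=\ell_0$, or $\ell_i\ne\ell_f$ and there is a clock reset on an incoming edge to $\ell_i$; and $\ell_j=\ell_f$, or there is a clock reset on an incoming edge to $\ell_j$. Reset-free PTA $\mathcal{A}(\ell_i,\ell_j)$: obtained from a copy of $\mathcal{A}$ by: (1) creating a duplicate $\ell_j'$ of $\ell_j$; (2) replacing each incoming edge $(\ell,g,a,\emptyset,\ell_j)$ (without reset) by $(\ell,g,a,\emptyset,\ell_j')$; (3) if $\ell_j\ne\ell_f$, replacing each outgoing edge $(\ell_j,g,a,R,\ell)$ by $(\ell_j',g,a,R,\ell)$;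 otherwise making $\ell_j'$ urgent and adding an edge $(\ell_j',\mathrm{True},\epsilon,\emptyset,\ell_j)$; (4) removing any upper-bound invariant on $\ell_j$ and making it urgent; (5) setting as initial location $\ell_i$ if $\ell_i\ne\ell_j$, and $\ell_j'$ otherwise; (6) removing any clock reset on incoming edges to $\ell_j$, and pruning all other edges featuring a clock reset, and all outgoing edges from $\ell_f$; (7) adding a parameter $d$, and a guard $x=d$ to all incoming edges to $\ell_j$. Set $Z_{\ell_i,\ell_j}=\mathrm{EFsynth}(\mathcal{A}(\ell_i,\ell_j),\{\ell_j\})$ (a "parametric zone"). Automaton of the zones $\hat{\mathcal{A}}$: the finite automaton whose states are exactly the locations of $\mathcal{A}$, with $\ell_0$ initial and $\ell_f$ final, and with, for each $(\ell_i,\ell_j)\in FrP(\mathcal{A},\ell_f)$, a transition from $\ell_i$ to $\ell_j$ labeled by $Z_{\ell_i,\ell_j}$. Operators. A parametric zone is a union $\bigcup_i C_i$ of convex polyhedra, each $C_i$ being a conjunction of inequalities $\alpha d+\sum_{k}\beta_k p_k+\gamma\bowtie 0$ with $\alpha,\beta_k,\gamma\in\mathbb{Z}$. Write $C_i=C_i^{d}\cap C_i^{\mathbb{P}}$, where $C_i^{d}$ consists of the inequalities with $\alpha\ne0$, written in the form $d\bowtie c$ with $c=\frac{\sum_k\beta_k p_k+\gamma}{-\alpha}$, and $C_i^{\mathbb{P}}$ of those with $\alpha=0$. Let $Z=\bigcup_i C_i$ and $Z'=\bigcup_j C'_j$. - $Z\,\bar{.}\,Z'$ is the addition of the time durations and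 intersection of the parameter constraints of the two zones. Formally, $Z\,\bar{.}\,Z'=\bigcup_{i,j}\big(C_{i,j}^{d}\cap C_{i,j}^{\mathbb{P}}\big)$, where $C_{i,j}^{\mathbb{P}}=C_i^{\mathbb{P}}\cap C_j'^{\mathbb{P}}$ and, for all $(d\bowtie c_i)\in C_i^{d}$ and $(d\bowtie' c_j)\in C_j'^{d}$, if ${\bowtie},{\bowtie'}\in\{<,\le,=\}$ or ${\bowtie},{\bowtie'}\in\{>,\ge,=\}$, then $(d\bowtie'' c_i+c_j)\in C_{i,j}^{d}$, where $\bowtie''$ is in the same direction as $\bowtie$ and $\bowtie'$ and is a strict inequality if either $\bowtie$ or $\bowtie'$ is strict, an equality if both are equalities, and a non-strict inequality otherwise. - $Z^{\bar *}=\bigcup_{K\in\mathbb{N}}\{d=0\}(\bar{.}\,Z)^K$, where $(\bar{.}\,Z)$ is repeated $K$ times; $\{d=0\}$ corresponds to the case where the loop is never taken and is neutral for $\bar{.}$. - $Z\,\bar{+}\,Z'=Z\cup Z'$. The result of each operation is again a (possibly infinite) union of convex polyhedra, so the operators can be nested.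
   Formalization: Added: if a resetting edge enters ℓ_f, I(ℓ_f) holds at x=0 for all v; zones are written with explicit bounds such as d≥0 and each C^P contains all implied parameter constraints; the run with no step exists even if I(ℓ_0) fails at 0. Without these the claim fails. *)

theory Defs
  imports Complex_Main
begin

section \<open>Parametric timed automata\<close>

datatype rel = Lt | Le | Eq | Ge | Gt

fun holds :: "rel \<Rightarrow> real \<Rightarrow> real \<Rightarrow> bool" where
  "holds Lt a b \<longleftrightarrow> a < b"
| "holds Le a b \<longleftrightarrow> a \<le> b"
| "holds Eq a b \<longleftrightarrow> a = b"
| "holds Ge a b \<longleftrightarrow> a \<ge> b"
| "holds Gt a b \<longleftrightarrow> a > b"

text \<open>The pair \<open>(\<beta>, \<gamma>)\<close> stands for the linear term \<open>(\<Sum>p. \<beta> p * p) + \<gamma>\<close>.\<close>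

type_synonym 'p lin = "('p \<Rightarrow> int) \<times> int"

definition lin_val :: "('p::finite \<Rightarrow> real) \<Rightarrow> 'p lin \<Rightarrow> real" where
  "lin_val w t = (\<Sum>p\<in>UNIV. of_int (fst t p) * w p) + of_int (snd t)"

text \<open>A guard is a conjunction of inequalities \<open>x \<bowtie> t\<close>; the empty list is the guard True.\<close>

type_synonym ('x, 'p) guard = "('x \<times> rel \<times> 'p lin) list"

definition sat :: "('p::finite \<Rightarrow> real) \<Rightarrow> ('x \<Rightarrow> real) \<Rightarrow> ('x, 'p) guard \<Rightarrow> bool" where
  "sat w \<mu> g \<longleftrightarrow> (\<forall>(x, r, t)\<in>set g. holds r (\<mu> x) (lin_val w t))"

type_synonym ('a, 'l, 'x, 'p) edge = "'l \<times> ('x, 'p) guard \<times> 'a \<times> 'x set \<times> 'l"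

text \<open>Actions, locations, clocks and parameters are the elements of the (finite) types
  \<open>'a\<close>, \<open>'l\<close>, \<open>'x\<close> and \<open>'p\<close>.\<close>

record ('a, 'l, 'x, 'p) pta =
  init_loc :: 'l
  priv_loc :: 'l
  final_loc :: 'l
  inv :: "'l \<Rightarrow> ('x, 'p) guard"
  edges :: "('a, 'l, 'x, 'p) edge set"
  urgent :: "'l set"

text \<open>Parameter valuations are real-valued here, so that the duration parameter added below
  is covered; the values of the other parameters are always natural numbers.\<close>

type_synonym ('l, 'x) state = "'l \<times> ('x \<Rightarrow> real)"

definition init_state :: "('a, 'l, 'x, 'p) pta \<Rightarrow> ('l, 'x) state" where
  "init_state A = (init_loc A, \<lambda>_. 0)"

fun step :: "('a, 'l, 'x, 'p::finite) pta \<Rightarrow> ('p \<Rightarrow> real) \<Rightarrow>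
    ('l, 'x) state \<Rightarrow> real \<times> ('a, 'l, 'x, 'p) edge \<Rightarrow> ('l, 'x) state \<Rightarrow> bool" where
  "step A w (l, \<mu>) (\<delta>, (l1, g, a, R, l2)) (l', \<mu>') \<longleftrightarrow>
     (l1, g, a, R, l2) \<in> edges A \<and> l1 = l \<and> l2 = l' \<and>
     \<delta> \<ge> 0 \<and> (l \<in> urgent A \<longrightarrow> \<delta> = 0) \<and>
     (\<forall>t. 0 \<le> t \<and> t \<le> \<delta> \<longrightarrow> sat w (\<lambda>y. \<mu> y + t) (inv A l)) \<and>
     sat w (\<lambda>y. \<mu> y + \<delta>) g \<and>
     \<mu>' = (\<lambda>y. if y \<in> R then 0 else \<mu> y + \<delta>) \<and>
     sat w \<mu>' (inv A l')"

text \<open>The invariant of the initial location is checked by the first step (at delay \<open>0\<close>). Thus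
  the run without steps always exists.\<close>

definition is_run :: "('a, 'l, 'x, 'p::finite) pta \<Rightarrow> ('p \<Rightarrow> real) \<Rightarrow>
    ('l, 'x) state list \<Rightarrow> (real \<times> ('a, 'l, 'x, 'p) edge) list \<Rightarrow> bool" where
  "is_run A w ss es \<longleftrightarrow> length ss = Suc (length es) \<and> ss ! 0 = init_state A \<and>
     (\<forall>i<length es. step A w (ss ! i) (es ! i) (ss ! Suc i))"

definition duration :: "(real \<times> 'e) list \<Rightarrow> real" where
  "duration es = (\<Sum>i<length es. fst (es ! i))"

definition PET :: "('a, 'l, 'x, 'p::finite) pta \<Rightarrow> (('p \<Rightarrow> nat) \<times> real) set" where
  "PET A = {(v, d). \<exists>ss es. is_run A (\<lambda>p. real (v p)) ss es \<and> duration es = d \<and>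
     fst (ss ! length es) = final_loc A \<and> (\<forall>i<length es. fst (ss ! i) \<noteq> final_loc A)}"

text \<open>The parameter \<open>W\<close> is the set of parameter valuations under consideration.\<close>

definition EFsynth :: "('p::finite \<Rightarrow> real) set \<Rightarrow> ('a, 'l, 'x, 'p) pta \<Rightarrow> 'l set \<Rightarrow>
    ('p \<Rightarrow> real) set" where
  "EFsynth W B T = {w\<in>W. \<exists>ss es. is_run B w ss es \<and> fst (ss ! length es) \<in> T}"


section \<open>Reset-free automata and parametric zones\<close>

definition reset_into :: "('a, 'l, 'x, 'p) pta \<Rightarrow> 'l \<Rightarrow> bool" where
  "reset_into A l \<longleftrightarrow> (\<exists>(l1, g, a, R, l2)\<in>edges A. l2 = l \<and> R \<noteq> {})"

definition FrP :: "('a, 'l, 'x, 'p) pta \<Rightarrow> ('l \<times> 'l) set" where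
  "FrP A = {(i, j). (i = init_loc A \<or> i \<noteq> final_loc A \<and> reset_into A i) \<and>
                    (j = final_loc A \<or> reset_into A j)}"

text \<open>In the reset-free automaton, the location \<open>None\<close> is the duplicate of \<open>j\<close>, the action
  \<open>None\<close> is the silent action, and the parameter \<open>None\<close> is the duration \<open>d\<close>.\<close>

fun lift_lin :: "'p lin \<Rightarrow> 'p option lin" where
  "lift_lin (\<beta>, \<gamma>) = (case_option 0 \<beta>, \<gamma>)"

definition lift_guard :: "('x, 'p) guard \<Rightarrow> ('x, 'p option) guard" where
  "lift_guard g = map (\<lambda>(x, r, t). (x, r, lift_lin t)) g"

definition dur :: "'p option lin" where
  "dur = (case_option 1 (\<lambda>_. 0), 0)"

text \<open>An equality is the conjunction of an upper and a lower bound; only the latter is kept.\<close>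

fun drop_upper :: "('x, 'p) guard \<Rightarrow> ('x, 'p) guard" where
  "drop_upper [] = []"
| "drop_upper ((x, r, t) # g) =
     (if r \<in> {Lt, Le} then [] else if r = Eq then [(x, Ge, t)] else [(x, r, t)]) @ drop_upper g"

type_synonym ('a, 'l, 'x, 'p) aux_edge = "('a option, 'l option, 'x, 'p option) edge"

fun copy_edge :: "('a, 'l, 'x, 'p) edge \<Rightarrow> ('a, 'l, 'x, 'p) aux_edge" where
  "copy_edge (l, g, a, R, l') = (Some l, lift_guard g, Some a, R, Some l')"

fun redirect_in :: "'l \<Rightarrow> ('a, 'l, 'x, 'p) aux_edge \<Rightarrow> ('a, 'l, 'x, 'p) aux_edge" where
  "redirect_in j (l, g, a, R, l') = (l, g, a, R, if l' = Some j \<and> R = {} then None else l')"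

fun redirect_out :: "'l \<Rightarrow> ('a, 'l, 'x, 'p) aux_edge \<Rightarrow> ('a, 'l, 'x, 'p) aux_edge" where
  "redirect_out j (l, g, a, R, l') = (if l = Some j then None else l, g, a, R, l')"

fun unreset_in :: "'l \<Rightarrow> ('a, 'l, 'x, 'p) aux_edge \<Rightarrow> ('a, 'l, 'x, 'p) aux_edge" where
  "unreset_in j (l, g, a, R, l') = (l, g, a, if l' = Some j then {} else R, l')"

fun guard_in :: "'x \<Rightarrow> 'l \<Rightarrow> ('a, 'l, 'x, 'p) aux_edge \<Rightarrow> ('a, 'l, 'x, 'p) aux_edge" where
  "guard_in x j (l, g, a, R, l') = (l, if l' = Some j then (x, Eq, dur) # g else g, a, R, l')"

definition reset_free_edges :: "('a, 'l, 'x, 'p) pta \<Rightarrow> 'x \<Rightarrow> 'l \<Rightarrow> ('a, 'l, 'x, 'p) aux_edge set"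
  where
  "reset_free_edges A x j =
    (let E1 = copy_edge ` edges A;
         E2 = redirect_in j ` E1;
         E3 = (if j \<noteq> final_loc A then redirect_out j ` E2
               else insert (None, [], None, {}, Some j) E2);
         E4 = unreset_in j ` E3;
         E5 = {(l, g, a, R, l')\<in>E4. R = {} \<and> l \<noteq> Some (final_loc A)}
     in guard_in x j ` E5)"

definition reset_free :: "('a, 'l, 'x, 'p) pta \<Rightarrow> 'x \<Rightarrow> 'l \<Rightarrow> 'l \<Rightarrow>
    ('a option, 'l option, 'x, 'p option) pta" where
  "reset_free A x i j =
    \<lparr> init_loc = (if i \<noteq> j then Some i else None),
      priv_loc = Some (priv_loc A),
      final_loc = Some (final_loc A),
      inv = (\<lambda>l. case l of
                None \<Rightarrow> lift_guard (inv A j)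
              | Some k \<Rightarrow> lift_guard (if k = j then drop_upper (inv A k) else inv A k)),
      edges = reset_free_edges A x j,
      urgent = insert (Some j) (Some ` urgent A) \<union>
               (if j = final_loc A \<or> j \<in> urgent A then {None} else {}) \<rparr>"

definition with_dur :: "('p \<Rightarrow> nat) \<Rightarrow> real \<Rightarrow> 'p option \<Rightarrow> real" where
  "with_dur v d = case_option d (\<lambda>p. real (v p))"

definition zone :: "('a, 'l, 'x, 'p::finite) pta \<Rightarrow> 'x \<Rightarrow> 'l \<Rightarrow> 'l \<Rightarrow>
    (('p \<Rightarrow> nat) \<times> real) set" where
  "zone A x i j =
    {(v, d). with_dur v d \<in> EFsynth {with_dur v' d' |v' d'. d' \<ge> 0} (reset_free A x i j) {Some j}}"


section \<open>The automaton of the zones\<close>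

record ('s, 'b) nfa =
  nfa_init :: 's
  nfa_finals :: "'s set"
  nfa_trans :: "('s \<times> 'b \<times> 's) set"

inductive nfa_path :: "('s \<times> 'b \<times> 's) set \<Rightarrow> 's \<Rightarrow> 'b list \<Rightarrow> 's \<Rightarrow> bool" for T where
  nfa_nil: "nfa_path T q [] q"
| nfa_cons: "(q, b, q') \<in> T \<Longrightarrow> nfa_path T q' u q'' \<Longrightarrow> nfa_path T q (b # u) q''"

definition nfa_lang :: "('s, 'b) nfa \<Rightarrow> 'b list set" where
  "nfa_lang M = {u. \<exists>q\<in>nfa_finals M. nfa_path (nfa_trans M) (nfa_init M) u q}"

definition zone_automaton :: "('a, 'l, 'x, 'p::finite) pta \<Rightarrow> 'x \<Rightarrow>
    ('l, (('p \<Rightarrow> nat) \<times> real) set) nfa" where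
  "zone_automaton A x =
    \<lparr> nfa_init = init_loc A, nfa_finals = {final_loc A},
      nfa_trans = {(i, zone A x i j, j) |i j. (i, j) \<in> FrP A} \<rparr>"


section \<open>Regular expressions\<close>

datatype 'b rexp =
  Zero | One | Atom 'b | Plus "'b rexp" "'b rexp" | Times "'b rexp" "'b rexp" | Star "'b rexp"

fun lang :: "'b rexp \<Rightarrow> 'b list set" where
  "lang Zero = {}"
| "lang One = {[]}"
| "lang (Atom b) = {[b]}"
| "lang (Plus r s) = lang r \<union> lang s"
| "lang (Times r s) = {u @ u' |u u'. u \<in> lang r \<and> u' \<in> lang s}"
| "lang (Star r) = {concat us |us. set us \<subseteq> lang r}"


section \<open>Operators on unions of convex polyhedra\<close>

text \<open>The triple \<open>(\<alpha>, t, r)\<close> stands for the inequality \<open>\<alpha> * d + t \<bowtie> 0\<close>, with \<open>\<bowtie>\<close> given by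
  \<open>r\<close>; a polyhedron is a finite conjunction of such inequalities, and a union of polyhedra may be
  infinite.\<close>

type_synonym 'p ineq = "int \<times> 'p lin \<times> rel"
type_synonym 'p poly = "'p ineq list"
type_synonym 'p polys = "'p poly set"

fun ineq_holds :: "('p::finite \<Rightarrow> nat) \<Rightarrow> real \<Rightarrow> 'p ineq \<Rightarrow> bool" where
  "ineq_holds v d (\<alpha>, t, r) \<longleftrightarrow> holds r (of_int \<alpha> * d + lin_val (\<lambda>p. real (v p)) t) 0"

definition polys_sem :: "'p::finite polys \<Rightarrow> (('p \<Rightarrow> nat) \<times> real) set" where
  "polys_sem Z = {(v, d). \<exists>C\<in>Z. \<forall>k\<in>set C. ineq_holds v d k}"

definition d_part :: "'p poly \<Rightarrow> 'p poly" where
  "d_part C = filter (\<lambda>(\<alpha>, t, r). \<alpha> \<noteq> 0) C"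

definition p_part :: "'p poly \<Rightarrow> 'p poly" where
  "p_part C = filter (\<lambda>(\<alpha>, t, r). \<alpha> = 0) C"

fun flip :: "rel \<Rightarrow> rel" where
  "flip Lt = Gt" | "flip Le = Ge" | "flip Eq = Eq" | "flip Ge = Le" | "flip Gt = Lt"

text \<open>An equivalent inequality whose \<open>\<alpha>\<close> is positive if it was nonzero: the relation is then
  that of the solved form \<open>d \<bowtie> c\<close>, where \<open>c = t / (- \<alpha>)\<close>.\<close>

fun orient :: "'p ineq \<Rightarrow> 'p ineq" where
  "orient (\<alpha>, (\<beta>, \<gamma>), r) =
     (if \<alpha> < 0 then (- \<alpha>, (\<lambda>p. - \<beta> p, - \<gamma>), flip r) else (\<alpha>, (\<beta>, \<gamma>), r))"

definition d_rel :: "'p ineq \<Rightarrow> rel" where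
  "d_rel k = snd (snd (orient k))"

definition d_bound :: "('p::finite \<Rightarrow> nat) \<Rightarrow> 'p ineq \<Rightarrow> real" where
  "d_bound v k = lin_val (\<lambda>p. real (v p)) (fst (snd k)) / (- of_int (fst k))"

definition same_direction :: "rel \<Rightarrow> rel \<Rightarrow> bool" where
  "same_direction r r' \<longleftrightarrow> {r, r'} \<subseteq> {Lt, Le, Eq} \<or> {r, r'} \<subseteq> {Gt, Ge, Eq}"

definition join_rel :: "rel \<Rightarrow> rel \<Rightarrow> rel" where
  "join_rel r r' =
     (if r = Eq \<and> r' = Eq then Eq
      else if {r, r'} \<subseteq> {Lt, Le, Eq} then (if Lt \<in> {r, r'} then Lt else Le)
      else (if Gt \<in> {r, r'} then Gt else Ge))"

text \<open>The inequality \<open>d \<bowtie>'' c + c'\<close>, multiplied by \<open>\<alpha> * \<alpha>'\<close> in order to keep integer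
  coefficients; see \<open>add_bounds_correct\<close> below.\<close>

fun add_oriented :: "'p ineq \<Rightarrow> 'p ineq \<Rightarrow> 'p ineq" where
  "add_oriented (\<alpha>, (\<beta>, \<gamma>), r) (\<alpha>', (\<beta>', \<gamma>'), r') =
     (\<alpha> * \<alpha>', (\<lambda>p. \<alpha>' * \<beta> p + \<alpha> * \<beta>' p, \<alpha>' * \<gamma> + \<alpha> * \<gamma>'), join_rel r r')"

definition add_bounds :: "'p ineq \<Rightarrow> 'p ineq \<Rightarrow> 'p ineq" where
  "add_bounds k k' = add_oriented (orient k) (orient k')"

definition poly_dot :: "'p poly \<Rightarrow> 'p poly \<Rightarrow> 'p poly" where
  "poly_dot C C' =
     [add_bounds k k'. k \<leftarrow> d_part C, k' \<leftarrow> d_part C', same_direction (d_rel k) (d_rel k')]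
     @ p_part C @ p_part C'"

definition polys_dot :: "'p polys \<Rightarrow> 'p polys \<Rightarrow> 'p polys" where
  "polys_dot Z Z' = {poly_dot C C' |C C'. C \<in> Z \<and> C' \<in> Z'}"

definition polys_unit :: "'p polys" where
  "polys_unit = {[(1, (\<lambda>_. 0, 0), Eq)]}"

definition polys_star :: "'p polys \<Rightarrow> 'p polys" where
  "polys_star Z = (\<Union>K. ((\<lambda>Y. polys_dot Y Z) ^^ K) polys_unit)"

text \<open>The constants of regular expressions are interpreted by the neutral elements; in
  particular \<open>One\<close> is treated like \<open>Star Zero\<close>.\<close>

fun zone_expr :: "('b \<Rightarrow> 'p polys) \<Rightarrow> 'b rexp \<Rightarrow> 'p polys" where
  "zone_expr rep Zero = {}"
| "zone_expr rep One = polys_unit"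
| "zone_expr rep (Atom b) = rep b"
| "zone_expr rep (Plus r s) = zone_expr rep r \<union> zone_expr rep s"
| "zone_expr rep (Times r s) = polys_dot (zone_expr rep r) (zone_expr rep s)"
| "zone_expr rep (Star r) = polys_star (zone_expr rep r)"

text \<open>The dot operates on inequalities, not on sets of points, so its outcome depends on how a
  zone is written as a union of polyhedra. The part without \<open>d\<close> of each polyhedron has to contain
  all constraints on the parameters: if \<open>p \<le> d \<and> d \<le> q\<close> did not come with \<open>p \<le> q\<close>, then its dot
  with \<open>0 \<le> d \<and> d \<le> 5\<close> would be \<open>p \<le> d \<and> d \<le> q + 5\<close>, which has solutions with \<open>q < p\<close>. Likewise
  lower bounds on \<open>d\<close> have to be explicit, even \<open>0 \<le> d\<close>; this is ensured by \<open>polys_sem\<close> ranging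
  over all real \<open>d\<close>.\<close>

definition represents :: "'p::finite polys \<Rightarrow> (('p \<Rightarrow> nat) \<times> real) set \<Rightarrow> bool" where
  "represents Z S \<longleftrightarrow> polys_sem Z = S \<and>
     (\<forall>C\<in>Z. \<forall>v. (\<forall>k\<in>set (p_part C). ineq_holds v 0 k) \<longrightarrow> (\<exists>d. \<forall>k\<in>set C. ineq_holds v d k))"


section \<open>Correctness of the solved forms, existence of representations\<close>

lemma lin_val_neg: "lin_val w (\<lambda>p. - \<beta> p, - \<gamma>) = - lin_val w (\<beta>, \<gamma>)"
  by (simp add: lin_val_def sum_negf)

lemma lin_val_comb:
  "lin_val w (\<lambda>p. a * \<beta> p + b * \<beta>' p, a * \<gamma> + b * \<gamma>') =
   of_int a * lin_val w (\<beta>, \<gamma>) + of_int b * lin_val w (\<beta>', \<gamma>')"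
  by (simp add: lin_val_def sum.distrib sum_distrib_left algebra_simps)

lemma holds_flip: "holds (flip r) (- a) 0 \<longleftrightarrow> holds r a 0"
  by (cases r) auto

lemma holds_solved:
  assumes "a > (0::real)"
  shows "holds r (a * d + b) 0 \<longleftrightarrow> holds r d (b / (- a))"
  using assms by (cases r) (auto simp: field_simps)

lemma orient_simps:
  assumes "fst k \<noteq> 0"
  obtains \<alpha> \<beta> \<gamma> where "orient k = (\<alpha>, (\<beta>, \<gamma>), d_rel k)" "\<alpha> > 0"
    "d_bound v k = lin_val (\<lambda>p. real (v p)) (\<beta>, \<gamma>) / (- of_int \<alpha>)"
    "\<And>d. ineq_holds v d k \<longleftrightarrow> ineq_holds v d (orient k)"
proof -
  obtain \<alpha> \<beta> \<gamma> r where k: "k = (\<alpha>, (\<beta>, \<gamma>), r)" by (metis prod.exhaust)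
  have f: "holds (flip r) (- (of_int \<alpha> * d) - lin_val (\<lambda>p. real (v p)) (\<beta>, \<gamma>)) 0 \<longleftrightarrow>
     holds r (of_int \<alpha> * d + lin_val (\<lambda>p. real (v p)) (\<beta>, \<gamma>)) 0" for d
    using holds_flip[of r "of_int \<alpha> * d + lin_val (\<lambda>p. real (v p)) (\<beta>, \<gamma>)"] by simp
  show thesis
  proof (cases "\<alpha> < 0")
    case True
    show thesis
      by (rule that[of "- \<alpha>" "\<lambda>p. - \<beta> p" "- \<gamma>"])
        (use True f in \<open>auto simp: k d_rel_def d_bound_def lin_val_neg\<close>)
  next
    case False
    show thesis
      by (rule that[of \<alpha> \<beta> \<gamma>]) (use False assms in \<open>auto simp: k d_rel_def d_bound_def\<close>)
  qed
qed

lemma ineq_solved_form: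
  assumes "fst k \<noteq> 0"
  shows "ineq_holds v d k \<longleftrightarrow> holds (d_rel k) d (d_bound v k)"
proof -
  obtain \<alpha> \<beta> \<gamma> where o: "orient k = (\<alpha>, (\<beta>, \<gamma>), d_rel k)" "\<alpha> > 0"
    "d_bound v k = lin_val (\<lambda>p. real (v p)) (\<beta>, \<gamma>) / (- of_int \<alpha>)"
    "ineq_holds v d k \<longleftrightarrow> ineq_holds v d (orient k)"
    using orient_simps[OF assms, of v] by metis
  show ?thesis
    using holds_solved[of "of_int \<alpha>"] o by simp
qed

lemma add_bounds_correct:
  assumes "fst k \<noteq> 0" "fst k' \<noteq> 0"
  shows "ineq_holds v d (add_bounds k k') \<longleftrightarrow>
    holds (join_rel (d_rel k) (d_rel k')) d (d_bound v k + d_bound v k')"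
proof -
  let ?L = "lin_val (\<lambda>p. real (v p))"
  obtain \<alpha> \<beta> \<gamma> where o: "orient k = (\<alpha>, (\<beta>, \<gamma>), d_rel k)" "\<alpha> > 0"
    "d_bound v k = ?L (\<beta>, \<gamma>) / (- of_int \<alpha>)"
    using orient_simps[OF assms(1), of v] by metis
  obtain \<alpha>' \<beta>' \<gamma>' where o': "orient k' = (\<alpha>', (\<beta>', \<gamma>'), d_rel k')" "\<alpha>' > 0"
    "d_bound v k' = ?L (\<beta>', \<gamma>') / (- of_int \<alpha>')"
    using orient_simps[OF assms(2), of v] by metis
  have "d_bound v k + d_bound v k' =
      (of_int \<alpha>' * ?L (\<beta>, \<gamma>) + of_int \<alpha> * ?L (\<beta>', \<gamma>')) / (- (of_int \<alpha> * of_int \<alpha>'))"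
    using o(2) o'(2) unfolding o(3) o'(3) by (simp add: field_simps)
  then show ?thesis
    using holds_solved[of "of_int \<alpha> * of_int \<alpha>'"] o(1,2) o'(1,2)
    by (simp add: add_bounds_def lin_val_comb)
qed

text \<open>Every zone has a representation in the sense of \<open>represents\<close>: it is closed under replacing \<open>d\<close> by another element of
  the same open unit interval between integers, since all other bounds are integers.\<close>

definition squash :: "real \<Rightarrow> real \<Rightarrow> real \<Rightarrow> real" where
  "squash d d' t = (if t \<in> \<int> then t else if \<lfloor>t\<rfloor> = \<lfloor>d\<rfloor> then d' else t)"

lemma floor_nonint: "d \<notin> \<int> \<Longrightarrow> of_int \<lfloor>d\<rfloor> < (d::real)"
  by (metis Ints_of_int floor_less_iff linorder_not_less of_int_floor_le order_le_less)

lemma squash_props: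
  assumes "d \<notin> \<int>" "d' \<notin> \<int>" "\<lfloor>d'\<rfloor> = \<lfloor>d\<rfloor>"
  shows "squash d d' d = d'" "squash d d' 0 = 0" "s \<le> t \<Longrightarrow> squash d d' s \<le> squash d d' t"
    "holds r s (of_int n) \<Longrightarrow> holds r (squash d d' s) (of_int n)"
proof -
  show "squash d d' d = d'" "squash d d' 0 = 0" using assms by (auto simp: squash_def)
  have fl: "\<lfloor>squash d d' u\<rfloor> = \<lfloor>u\<rfloor>" "squash d d' u \<in> \<int> \<longleftrightarrow> u \<in> \<int>" for u
    using assms by (auto simp: squash_def)
  have lt: "of_int m < u \<longleftrightarrow> m < \<lfloor>u\<rfloor> \<or> m = \<lfloor>u\<rfloor> \<and> u \<notin> \<int>" for m and u :: real
  proof (cases "m = \<lfloor>u\<rfloor>")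
    case True
    then show ?thesis using floor_nonint[of u] by (auto elim!: Ints_cases)
  next
    case False
    then show ?thesis by linarith
  qed
  show "squash d d' s \<le> squash d d' t" if "s \<le> t"
  proof (cases "\<lfloor>s\<rfloor> = \<lfloor>t\<rfloor>")
    case True
    have "of_int \<lfloor>d\<rfloor> < d'" using floor_nonint[OF assms(2)] assms(3) by simp
    with True that show ?thesis
      by (smt (verit) squash_def Ints_cases floor_of_int floor_nonint)
  next
    case False
    then have "\<lfloor>s\<rfloor> < \<lfloor>t\<rfloor>" using that floor_mono[of s t] by linarith
    then have "\<lfloor>squash d d' s\<rfloor> < \<lfloor>squash d d' t\<rfloor>" by (simp add: fl)
    then show ?thesis by linarith
  qed
  have a: "of_int n < squash d d' s \<longleftrightarrow> of_int n < s" unfolding lt fl ..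
  have b: "of_int n \<le> squash d d' s \<longleftrightarrow> of_int n \<le> s" by (metis fl(1) le_floor_iff)
  show "holds r (squash d d' s) (of_int n)" if "holds r s (of_int n)"
    using that a b by (cases r) auto
qed

definition int_guard :: "('x, 'p option) guard \<Rightarrow> bool" where
  "int_guard g \<longleftrightarrow> (\<forall>(y, r, t)\<in>set g. r = Eq \<and> t = dur \<or> (\<exists>s. t = lift_lin s))"

lemma lin_val_dur: "lin_val (with_dur v d) dur = d"
  by (simp add: lin_val_def dur_def with_dur_def UNIV_option_conv sum.reindex)

lemma lin_val_lift: "lin_val (with_dur v d) (lift_lin s) = of_int ((\<Sum>p\<in>UNIV. fst s p * int (v p)) + snd s)"
  by (cases s) (simp add: lin_val_def with_dur_def UNIV_option_conv sum.reindex)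

lemma int_guard_lift: "int_guard (lift_guard g)"
  by (auto simp: int_guard_def lift_guard_def)

lemma int_guard_inv: "int_guard (inv (reset_free A x i j) l)"
  by (auto simp: reset_free_def int_guard_lift split: option.splits)

lemma int_guard_edge:
  fixes A :: "('a, 'l, 'x, 'p) pta"
  assumes "(l, g, a, R, l') \<in> edges (reset_free A x i j)"
  shows "R = {}" "int_guard g"
proof -
  define G where "G = (\<lambda>E :: ('a, 'l, 'x, 'p) aux_edge. int_guard (fst (snd E)))"
  have G1: "G (copy_edge E)" for E by (cases E) (simp add: G_def int_guard_lift)
  have G2: "G (redirect_in k E) = G E" "G (redirect_out k E) = G E" "G (unreset_in k E) = G E"
    for k E by (cases E; simp add: G_def)+
  have G3: "G E \<Longrightarrow> G (guard_in x j E)" for E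
    by (cases E) (auto simp: G_def int_guard_def)
  have G4: "G (None, [], None, {}, Some k)" for k by (simp add: G_def int_guard_def)
  obtain E where E: "(l, g, a, R, l') = guard_in x j E" and E5:
    "(case E of (l, g, a, R, l') \<Rightarrow> R = {} \<and> l \<noteq> Some (final_loc A))"
    "E \<in> unreset_in j ` (if j \<noteq> final_loc A then redirect_out j ` redirect_in j ` copy_edge ` edges A
       else insert (None, [], None, {}, Some j) (redirect_in j ` copy_edge ` edges A))"
    using assms unfolding reset_free_def reset_free_edges_def Let_def pta.simps by blast
  show "R = {}" using E E5(1) by (cases E) simp
  have "G E" using E5(2)
    by (auto simp: G1 G2 G4 simp del: copy_edge.simps redirect_in.simps redirect_out.simps
        unreset_in.simps split: if_split_asm)
  then have "G (l, g, a, R, l')" unfolding E by (rule G3)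
  then show "int_guard g" by (simp add: G_def)
qed

lemma sat_squash:
  assumes "d \<notin> \<int>" "d' \<notin> \<int>" "\<lfloor>d'\<rfloor> = \<lfloor>d\<rfloor>" "int_guard g" "sat (with_dur v d) \<mu> g"
  shows "sat (with_dur v d') (\<lambda>y. squash d d' (\<mu> y)) g"
  unfolding sat_def
proof (clarify)
  fix y r t assume g: "(y, r, t) \<in> set g"
  then have h: "holds r (\<mu> y) (lin_val (with_dur v d) t)" using assms(5) by (auto simp: sat_def)
  from g assms(4) consider "r = Eq" "t = dur" | s where "t = lift_lin s"
    by (auto simp: int_guard_def)
  then show "holds r (squash d d' (\<mu> y)) (lin_val (with_dur v d') t)"
  proof cases
    case 1
    then show ?thesis using h squash_props(1)[OF assms(1-3)] by (simp add: lin_val_dur)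
  next
    case 2
    then show ?thesis using h squash_props(4)[OF assms(1-3)] unfolding 2 lin_val_lift by blast
  qed
qed

lemma sat_convex:
  assumes "sat w \<mu> g" "sat w \<mu>' g" "\<And>y. \<mu> y \<le> \<nu> y" "\<And>y. \<nu> y \<le> \<mu>' y"
  shows "sat w \<nu> g"
  unfolding sat_def
proof (clarify)
  fix y r t assume g: "(y, r, t) \<in> set g"
  then have "holds r (\<mu> y) (lin_val w t)" "holds r (\<mu>' y) (lin_val w t)"
    using assms(1,2) by (auto simp: sat_def)
  then show "holds r (\<nu> y) (lin_val w t)"
    using assms(3)[of y] assms(4)[of y] by (cases r) auto
qed

lemma step_squash:
  fixes x :: 'x
  assumes d: "d \<notin> \<int>" "d' \<notin> \<int>" "\<lfloor>d'\<rfloor> = \<lfloor>d\<rfloor>" and x: "(UNIV :: 'x set) = {x}"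
    and st: "step (reset_free A x i j) (with_dur v d) (l, \<mu>) (\<delta>, E) (l', \<mu>')"
  shows "step (reset_free A x i j) (with_dur v d') (l, \<lambda>y. squash d d' (\<mu> y))
    (squash d d' (\<mu> x + \<delta>) - squash d d' (\<mu> x), E) (l', \<lambda>y. squash d d' (\<mu>' y))"
proof -
  let ?B = "reset_free A x i j" and ?s = "squash d d'"
  have yx: "y = x" for y using x by auto
  obtain l1 g a R l2 where E: "E = (l1, g, a, R, l2)" by (metis prod.exhaust)
  have c: "E \<in> edges ?B" "l1 = l" "l2 = l'" "\<delta> \<ge> 0" "l \<in> urgent ?B \<longrightarrow> \<delta> = 0"
    "\<And>t. 0 \<le> t \<Longrightarrow> t \<le> \<delta> \<Longrightarrow> sat (with_dur v d) (\<lambda>y. \<mu> y + t) (inv ?B l)"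
    "sat (with_dur v d) (\<lambda>y. \<mu> y + \<delta>) g"
    "\<mu>' = (\<lambda>y. if y \<in> R then 0 else \<mu> y + \<delta>)" "sat (with_dur v d) \<mu>' (inv ?B l')"
    using st by (auto simp: E)
  have R: "R = {}" "int_guard g" using int_guard_edge c(1) E by metis+
  note s = sat_squash[OF d]
  have "sat (with_dur v d') (\<lambda>y. ?s (\<mu> y + 0)) (inv ?B l)"
    "sat (with_dur v d') (\<lambda>y. ?s (\<mu> y + \<delta>)) (inv ?B l)"
    by (rule s[OF int_guard_inv], rule c(6), use c(4) in simp_all)+
  then have "sat (with_dur v d') (\<lambda>y. ?s (\<mu> y) + t) (inv ?B l)"
    if "0 \<le> t" "t \<le> ?s (\<mu> x + \<delta>) - ?s (\<mu> x)" for t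
  proof (rule sat_convex)
    show "?s (\<mu> y + 0) \<le> ?s (\<mu> y) + t" for y using that by simp
    show "?s (\<mu> y) + t \<le> ?s (\<mu> y + \<delta>)" for y using that yx[of y] by auto
  qed
  moreover have "sat (with_dur v d') (\<lambda>y. ?s (\<mu> y + \<delta>)) g"
    by (rule s[OF R(2) c(7)])
  moreover have "sat (with_dur v d') (\<lambda>y. ?s (\<mu>' y)) (inv ?B l')"
    by (rule s[OF int_guard_inv c(9)])
  moreover have "?s (\<mu> x) \<le> ?s (\<mu> x + \<delta>)" using squash_props(3)[OF d] c(4) by simp
  moreover have "?s (\<mu> y) + (?s (\<mu> x + \<delta>) - ?s (\<mu> x)) = ?s (\<mu> y + \<delta>)" for y
    using yx[of y] by simp
  ultimately show ?thesis using c(1-5,8) R by (auto simp: E)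
qed

lemma zone_squash:
  fixes A :: "('a, 'l, 'x, 'p::finite) pta" and x :: 'x
  assumes d: "d \<notin> \<int>" "d' \<notin> \<int>" "\<lfloor>d'\<rfloor> = \<lfloor>d\<rfloor>" and x: "(UNIV :: 'x set) = {x}"
    and z: "(v, d) \<in> zone A x i j"
  shows "(v, d') \<in> zone A x i j"
proof -
  let ?B = "reset_free A x i j" and ?s = "squash d d'"
  have wd: "with_dur v1 d1 = with_dur v2 d2 \<Longrightarrow> d1 = d2" for v1 v2 :: "'p \<Rightarrow> nat" and d1 d2
    by (drule fun_cong[where x = None]) (simp add: with_dur_def)
  from z obtain ss es where r: "is_run ?B (with_dur v d) ss es"
    "fst (ss ! length es) = Some j" and d0: "d \<ge> 0"
    using wd[of v d] by (auto simp: zone_def EFsynth_def)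
  define ss' where "ss' = map (\<lambda>(l, \<mu>). (l, \<lambda>y. ?s (\<mu> y))) ss"
  define es' where "es' = map (\<lambda>k. (?s (snd (ss ! k) x + fst (es ! k)) - ?s (snd (ss ! k) x), snd (es ! k)))
    [0..<length es]"
  have len: "length ss = Suc (length es)" "length ss' = Suc (length es)" "length es' = length es"
    using r(1) by (auto simp: is_run_def ss'_def es'_def)
  have "step ?B (with_dur v d') (ss' ! k) (es' ! k) (ss' ! Suc k)" if k: "k < length es" for k
  proof -
    obtain l \<mu> \<delta> E l' \<mu>' where e: "ss ! k = (l, \<mu>)" "es ! k = (\<delta>, E)" "ss ! Suc k = (l', \<mu>')"
      by (metis prod.exhaust)
    have "step ?B (with_dur v d) (l, \<mu>) (\<delta>, E) (l', \<mu>')" using r(1) k e by (auto simp: is_run_def)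
    from step_squash[OF d x this] show ?thesis using k e len by (simp add: ss'_def es'_def)
  qed
  moreover have "ss' ! 0 = init_state ?B"
    using r(1) squash_props(2)[OF d] len by (auto simp: is_run_def ss'_def init_state_def)
  ultimately have "is_run ?B (with_dur v d') ss' es'" using len by (simp add: is_run_def)
  moreover have "fst (ss' ! length es') = Some j"
    using r(2) len by (simp add: ss'_def split_beta)
  moreover have "d' \<ge> 0"
  proof -
    have "0 \<le> \<lfloor>d'\<rfloor>" using d0 d(3) by simp
    then show ?thesis by simp
  qed
  ultimately show ?thesis by (auto simp: zone_def EFsynth_def)
qed

lemma zones_representable:
  fixes A :: "('a, 'l, 'x, 'p::finite) pta" and x :: 'x
  assumes x: "(UNIV :: 'x set) = {x}"
  shows "\<exists>rep. \<forall>i j. represents (rep (zone A x i j)) (zone A x i j)"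
proof -
  obtain ps :: "'p list" where ps: "set ps = UNIV" using finite_list[OF finite[of UNIV]] by blast
  define pt :: "('p \<Rightarrow> nat) \<Rightarrow> 'p poly" where
    "pt v = map (\<lambda>p. (0, ((\<lambda>q. if q = p then 1 else 0), - int (v p)), Eq)) ps" for v
  define dt :: "real \<Rightarrow> 'p poly" where
    "dt d = (if d \<in> \<int> then [(1, ((\<lambda>_. 0), - \<lfloor>d\<rfloor>), Eq)]
      else [(1, ((\<lambda>_. 0), - \<lfloor>d\<rfloor>), Gt), (1, ((\<lambda>_. 0), - \<lfloor>d\<rfloor> - 1), Lt)])" for d
  have p0: "p_part (pt v @ dt d) = pt v" for v d
    by (auto simp: p_part_def pt_def dt_def intro!: filter_True)
  have pt: "(\<forall>k\<in>set (pt v). ineq_holds v' d k) \<longleftrightarrow> v' = v" for v v' d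
    by (auto simp: pt_def ps lin_val_def if_distrib[of real_of_int] if_distrib[of "\<lambda>a. a * _"] cong: if_cong)
  have dt: "(\<forall>k\<in>set (dt d). ineq_holds v d' k) \<longleftrightarrow> d' = d \<or> d \<notin> \<int> \<and> d' \<notin> \<int> \<and> \<lfloor>d'\<rfloor> = \<lfloor>d\<rfloor>" for d d' v
  proof (cases "d \<in> \<int>")
    case True
    then show ?thesis by (auto simp: dt_def lin_val_def elim!: Ints_cases)
  next
    case False
    have "of_int \<lfloor>d\<rfloor> < d' \<and> d' < of_int \<lfloor>d\<rfloor> + 1 \<longleftrightarrow> d' \<notin> \<int> \<and> \<lfloor>d'\<rfloor> = \<lfloor>d\<rfloor>"
    proof
      assume a: "of_int \<lfloor>d\<rfloor> < d' \<and> d' < of_int \<lfloor>d\<rfloor> + 1"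
      then have "\<lfloor>d'\<rfloor> = \<lfloor>d\<rfloor>" by (simp add: floor_eq)
      with a show "d' \<notin> \<int> \<and> \<lfloor>d'\<rfloor> = \<lfloor>d\<rfloor>" by (auto elim!: Ints_cases)
    next
      assume "d' \<notin> \<int> \<and> \<lfloor>d'\<rfloor> = \<lfloor>d\<rfloor>"
      then have "of_int \<lfloor>d\<rfloor> < d'" "\<lfloor>d'\<rfloor> = \<lfloor>d\<rfloor>" using floor_nonint[of d'] by auto
      then show "of_int \<lfloor>d\<rfloor> < d' \<and> d' < of_int \<lfloor>d\<rfloor> + 1"
        by linarith
    qed
    moreover have "(\<forall>k\<in>set (dt d). ineq_holds v d' k) \<longleftrightarrow>
        of_int \<lfloor>d\<rfloor> < d' \<and> d' < of_int \<lfloor>d\<rfloor> + 1"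
      using False by (auto simp: dt_def lin_val_def)
    ultimately have "(\<forall>k\<in>set (dt d). ineq_holds v d' k) \<longleftrightarrow> d' \<notin> \<int> \<and> \<lfloor>d'\<rfloor> = \<lfloor>d\<rfloor>"
      by (rule trans[rotated])
    then show ?thesis using False by blast
  qed
  define rep where "rep S = {pt v @ dt d |v d. (v, d) \<in> S}" for S
  have "represents (rep (zone A x i j)) (zone A x i j)" for i j
    unfolding represents_def
  proof (intro conjI ballI allI impI)
    have m: "(v', d') \<in> polys_sem (rep (zone A x i j)) \<longleftrightarrow>
        (\<exists>d. (v', d) \<in> zone A x i j \<and> (d' = d \<or> d \<notin> \<int> \<and> d' \<notin> \<int> \<and> \<lfloor>d'\<rfloor> = \<lfloor>d\<rfloor>))" for v' d'
    proof
      assume "(v', d') \<in> polys_sem (rep (zone A x i j))"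
      then obtain C where C: "C \<in> rep (zone A x i j)" "\<forall>k\<in>set C. ineq_holds v' d' k"
        unfolding polys_sem_def by blast
      from C(1) obtain v d where z: "(v, d) \<in> zone A x i j" and Ceq: "C = pt v @ dt d"
        unfolding rep_def by blast
      have k: "\<forall>k\<in>set (pt v). ineq_holds v' d' k" "\<forall>k\<in>set (dt d). ineq_holds v' d' k"
        using C(2) unfolding Ceq set_append ball_Un by simp_all
      show "\<exists>d. (v', d) \<in> zone A x i j \<and>
          (d' = d \<or> d \<notin> \<int> \<and> d' \<notin> \<int> \<and> \<lfloor>d'\<rfloor> = \<lfloor>d\<rfloor>)"
        using z k(1)[unfolded pt] k(2)[unfolded dt] by blast
    next
      assume "\<exists>d. (v', d) \<in> zone A x i j \<and>
          (d' = d \<or> d \<notin> \<int> \<and> d' \<notin> \<int> \<and> \<lfloor>d'\<rfloor> = \<lfloor>d\<rfloor>)"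
      then obtain d where z: "(v', d) \<in> zone A x i j"
        and k: "\<forall>k\<in>set (dt d). ineq_holds v' d' k"
        unfolding dt by blast
      have "\<forall>k\<in>set (pt v'). ineq_holds v' d' k" unfolding pt ..
      with k have "\<forall>k\<in>set (pt v' @ dt d). ineq_holds v' d' k" unfolding set_append ball_Un by blast
      then show "(v', d') \<in> polys_sem (rep (zone A x i j))"
        unfolding polys_sem_def rep_def using z by blast
    qed
    show "polys_sem (rep (zone A x i j)) = zone A x i j"
    proof (rule set_eqI)
      fix s :: "('p \<Rightarrow> nat) \<times> real"
      obtain v' d' where s: "s = (v', d')" by (metis prod.exhaust)
      show "s \<in> polys_sem (rep (zone A x i j)) \<longleftrightarrow> s \<in> zone A x i j"
        unfolding s m
      proof
        assume "\<exists>d. (v', d) \<in> zone A x i j \<and>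
          (d' = d \<or> d \<notin> \<int> \<and> d' \<notin> \<int> \<and> \<lfloor>d'\<rfloor> = \<lfloor>d\<rfloor>)"
        then obtain d where z: "(v', d) \<in> zone A x i j"
          and "d' = d \<or> d \<notin> \<int> \<and> d' \<notin> \<int> \<and> \<lfloor>d'\<rfloor> = \<lfloor>d\<rfloor>" by blast
        from this(2) show "(v', d') \<in> zone A x i j"
        proof (elim disjE conjE)
          assume "d' = d"
          with z show ?thesis by (simp only:)
        next
          assume "d \<notin> \<int>" "d' \<notin> \<int>" "\<lfloor>d'\<rfloor> = \<lfloor>d\<rfloor>"
          from zone_squash[OF this x z] show ?thesis .
        qed
      qed blast
    qed
    show "\<exists>d. \<forall>k\<in>set C. ineq_holds v d k"
      if "C \<in> rep (zone A x i j)" "\<forall>k\<in>set (p_part C). ineq_holds v 0 k" for C v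
    proof -
      from that(1) obtain v1 d1 where C: "C = pt v1 @ dt d1" by (auto simp: rep_def)
      have "v = v1" using that(2) unfolding C p0 pt .
      then have "\<forall>k\<in>set (pt v1). ineq_holds v d1 k" unfolding pt .
      moreover have "\<forall>k\<in>set (dt d1). ineq_holds v d1 k" unfolding dt by (rule disjI1) (rule refl)
      ultimately have "\<forall>k\<in>set C. ineq_holds v d1 k" unfolding C set_append ball_Un by (rule conjI)
      then show ?thesis by (rule exI)
    qed
  qed
  then show ?thesis by blast
qed

end

(* A run from the initial to the final location is cut at its resets. Between two resets the
   clock starts at 0 and runs freely, so its last value is the duration of the segment, which is
   what the reset-free automaton records in d. Hence PET is the union over the accepted words
   of the sums of their zones. The dot of polyhedra computes such a sum exactly: at a
   parameter valuation that satisfies the constraints without d, both polyhedra are non-empty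
   intervals of durations, and by Helly's theorem on the line, the sum of two such intervals is
   described by the pairwise sums of their bounds. *)

theory Submission
  imports Defs
begin

section \<open>Sums of polyhedra\<close>

text \<open>Three obstacles shape the proof. First, a zone tests only the lower bounds of the
  invariant of its target \<open>j\<close>, and at the clock value before the reset; it never tests
  the invariant at 0 after the reset. Cutting a run is harmless, since lower bounds that hold at 0
  hold at larger values. Gluing has to recover the invariant at 0: if \<open>j\<close> is not final,
  the run goes on and its next step tests it; at the final location nothing follows, and
  \<open>final_inv\<close> supplies the missing fact. Second, the dot is exact only on polyhedra
  whose part without \<open>d\<close> implies non-emptiness, so this property is carried through all
  nested operations. Third, if the initial location is final, transitions may leave it although only
  the empty run counts; their zones must be shown to contribute nothing but duration 0.\<close>

lemma holds_convex:
  assumes "holds r a c" "holds r b c" "a \<le> t" "t \<le> b"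
  shows "holds r t c"
  using assms by (cases r) auto

text \<open>Helly's theorem on the line. Choose a common point of every pair of constraints; if \<open>m k\<close>
  and \<open>M k\<close> are the least and the greatest point chosen for the pairs containing \<open>k\<close>, then
  \<open>m k \<le> M k'\<close> for all \<open>k\<close>, \<open>k'\<close>, and so the largest \<open>m k\<close> satisfies all constraints.\<close>

lemma holds_helly:
  fixes K :: "(rel \<times> real) set"
  assumes fin: "finite K"
    and pair: "\<And>r c r' c'. (r, c) \<in> K \<Longrightarrow> (r', c') \<in> K \<Longrightarrow> \<exists>t. holds r t c \<and> holds r' t c'"
  shows "\<exists>t. \<forall>(r, c)\<in>K. holds r t c"
proof (cases "K = {}")
  case False
  define Q where "Q S t \<longleftrightarrow> (\<forall>(r, c)\<in>S. holds r t c)" for S :: "(rel \<times> real) set" and t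
  \<comment> \<open>The point is chosen for the unordered pair, so the same point occurs in the
    minimum for one constraint and in the maximum for the other.\<close>
  define p where "p S = (SOME t. Q S t)" for S
  have p: "holds r (p {(r, c), k}) c" if "(r, c) \<in> K" "k \<in> K" for r c k
  proof -
    obtain r' c' where k: "k = (r', c')" by (cases k)
    have "\<exists>t. Q {(r, c), k} t" using pair that by (simp add: k Q_def)
    then have "Q {(r, c), k} (p {(r, c), k})" unfolding p_def by (rule someI_ex)
    then show ?thesis by (simp add: Q_def)
  qed
  define m where "m k = Min ((\<lambda>k'. p {k, k'}) ` K)" for k
  define M where "M k = Max ((\<lambda>k'. p {k, k'}) ` K)" for k
  have mM: "m k \<le> M k'" if "k \<in> K" "k' \<in> K" for k k'
  proof -
    have "m k \<le> p {k, k'}" unfolding m_def using fin that by simp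
    also have "\<dots> = p {k', k}" by (simp add: insert_commute)
    also have "\<dots> \<le> M k'" unfolding M_def using fin that by simp
    finally show ?thesis .
  qed
  have "holds r (Max (m ` K)) c" if k: "(r, c) \<in> K" for r c
  proof (rule holds_convex)
    have "m (r, c) \<in> (\<lambda>k'. p {(r, c), k'}) ` K" "M (r, c) \<in> (\<lambda>k'. p {(r, c), k'}) ` K"
      unfolding m_def M_def using fin False by (auto intro!: Min_in Max_in)
    then show "holds r (m (r, c)) c" "holds r (M (r, c)) c" using p[OF k] by auto
    show "m (r, c) \<le> Max (m ` K)" using fin k by simp
    show "Max (m ` K) \<le> M (r, c)" using fin False mM k by auto
  qed
  then show ?thesis by blast
qed simp

lemma holds_add:
  assumes "holds r a c" "holds r' b c'" "same_direction r r'"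
  shows "holds (join_rel r r') (a + b) (c + c')"
  using assms by (cases r; cases r') (auto simp: same_direction_def join_rel_def)

lemma holds_split:
  assumes "same_direction r r' \<Longrightarrow> holds (join_rel r r') s (c + c')"
  shows "\<exists>t. holds r t c \<and> holds r' (s - t) c'"
proof -
  let ?P = "\<lambda>t. holds r t c \<and> holds r' (s - t) c'"
  \<comment> \<open>An equality forces \<open>t\<close>. Otherwise \<open>s - t\<close> being
    bounded by \<open>c'\<close> bounds \<open>t\<close> by \<open>s - c'\<close> in the opposite
    direction. If \<open>r\<close> and \<open>r'\<close> agree, \<open>t\<close> therefore has to
    lie between \<open>c\<close> and \<open>s - c'\<close>, and the midpoint does; if they disagree,
    both bounds on \<open>t\<close> point the same way, and moving 1 beyond both is enough.\<close>
  have "?P (if r = Eq then c else if r' = Eq then s - c'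
      else if same_direction r r' then (c + s - c') / 2
      else if r \<in> {Lt, Le} then min c (s - c') - 1 else max c (s - c') + 1)"
    using assms
    by (cases r; cases r') (auto simp: same_direction_def join_rel_def field_simps)
  then show ?thesis by blast
qed

text \<open>With the first summand \<open>t\<close> as the only unknown, the second is
  \<open>s - t\<close>, and its bounds become flipped bounds on \<open>t\<close>. By
  \<open>holds_helly\<close> only pairs matter: two bounds from \<open>B\<close> share
  \<open>a0\<close>, two from \<open>B'\<close> share \<open>s - b0\<close>, and a mixed pair is
  compatible exactly by the condition on sums of bounds.\<close>

lemma bounds_sum:
  fixes B B' :: "(rel \<times> real) set"
  assumes "finite B" "finite B'"
    and B: "\<forall>(r, c)\<in>B. holds r a0 c" and B': "\<forall>(r, c)\<in>B'. holds r b0 c"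
  shows "(\<forall>(r, c)\<in>B. \<forall>(r', c')\<in>B'. same_direction r r' \<longrightarrow> holds (join_rel r r') s (c + c')) \<longleftrightarrow>
    (\<exists>a b. s = a + b \<and> (\<forall>(r, c)\<in>B. holds r a c) \<and> (\<forall>(r, c)\<in>B'. holds r b c))"
    (is "?L \<longleftrightarrow> ?R")
proof
  assume L: ?L
  define K where "K = B \<union> (\<lambda>(r, c). (flip r, s - c)) ` B'"
  have flip: "holds (flip r) t (s - c) \<longleftrightarrow> holds r (s - t) c" for r t c
    by (cases r) auto
  have mix: "\<exists>t. holds r t c \<and> holds r' (s - t) c'" if "(r, c) \<in> B" "(r', c') \<in> B'" for r c r' c'
    by (rule holds_split) (use L that in blast)
  have "\<exists>t. \<forall>(r, c)\<in>K. holds r t c"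
  proof (rule holds_helly)
    show "finite K" using assms by (simp add: K_def)
    fix r c r' c' assume "(r, c) \<in> K" "(r', c') \<in> K"
    then consider "(r, c) \<in> B" "(r', c') \<in> B"
      | r1 c1 where "(r, c) \<in> B" "(r1, c1) \<in> B'" "r' = flip r1" "c' = s - c1"
      | r1 c1 where "(r', c') \<in> B" "(r1, c1) \<in> B'" "r = flip r1" "c = s - c1"
      | r1 c1 r2 c2 where "(r1, c1) \<in> B'" "r = flip r1" "c = s - c1"
          "(r2, c2) \<in> B'" "r' = flip r2" "c' = s - c2"
      by (auto simp: K_def)
    then show "\<exists>t. holds r t c \<and> holds r' t c'"
    proof cases
      case 1
      then show ?thesis using B by blast
    next
      case 2
      then show ?thesis using mix by (simp add: flip)
    next
      case 3
      then show ?thesis using mix by (metis flip)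
    next
      case 4
      then have "holds r1 b0 c1" "holds r2 b0 c2" using B' by blast+
      then show ?thesis by (intro exI[of _ "s - b0"]) (simp add: 4 flip)
    qed
  qed
  then obtain t where t: "\<forall>(r, c)\<in>K. holds r t c" ..
  have "\<forall>(r, c)\<in>B. holds r t c" using t by (auto simp: K_def)
  moreover have "holds r (s - t) c" if "(r, c) \<in> B'" for r c
  proof -
    have "(flip r, s - c) \<in> K" using that by (force simp: K_def)
    then show ?thesis using t flip by blast
  qed
  ultimately show ?R by (intro exI[of _ t] exI[of _ "s - t"]) auto
next
  assume ?R
  then show ?L using holds_add by fast
qed

section \<open>Polyhedra at a fixed parameter valuation and exactness of the dot\<close>

definition poly_sat :: "('p::finite \<Rightarrow> nat) \<Rightarrow> real \<Rightarrow> 'p poly \<Rightarrow> bool" where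
  "poly_sat v d C \<longleftrightarrow> (\<forall>k\<in>set C. ineq_holds v d k)"

definition d_bounds :: "('p::finite \<Rightarrow> nat) \<Rightarrow> 'p poly \<Rightarrow> (rel \<times> real) set" where
  "d_bounds v C = (\<lambda>k. (d_rel k, d_bound v k)) ` set (d_part C)"

text \<open>Equivalently, \<open>p_part C\<close> describes the projection of \<open>C\<close> to
  the parameters: eliminating \<open>d\<close> yields no further constraint.\<close>

definition tight :: "'p::finite poly \<Rightarrow> bool" where
  "tight C \<longleftrightarrow> (\<forall>v. poly_sat v 0 (p_part C) \<longrightarrow> (\<exists>d. poly_sat v d C))"

lemma represents_iff: "represents Z S \<longleftrightarrow> polys_sem Z = S \<and> (\<forall>C\<in>Z. tight C)"
  by (simp add: represents_def tight_def poly_sat_def)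

lemma poly_sat_append [simp]: "poly_sat v d (C @ C') \<longleftrightarrow> poly_sat v d C \<and> poly_sat v d C'"
  by (auto simp: poly_sat_def)

lemma poly_sat_p_part: "poly_sat v d (p_part C) \<longleftrightarrow> poly_sat v 0 (p_part C)"
  by (auto simp: poly_sat_def p_part_def)

lemma fst_d_part: "k \<in> set (d_part C) \<Longrightarrow> fst k \<noteq> 0"
  by (auto simp: d_part_def)

lemma poly_sat_split:
  "poly_sat v d C \<longleftrightarrow> poly_sat v 0 (p_part C) \<and> (\<forall>(r, c)\<in>d_bounds v C. holds r d c)"
proof -
  have "poly_sat v d C \<longleftrightarrow> poly_sat v d (p_part C) \<and> poly_sat v d (d_part C)"
    unfolding poly_sat_def p_part_def d_part_def split_beta set_filter by blast
  moreover have "poly_sat v d (d_part C) \<longleftrightarrow> (\<forall>(r, c)\<in>d_bounds v C. holds r d c)"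
    unfolding poly_sat_def d_bounds_def ball_simps(9) prod.case
    by (intro ball_cong refl ineq_solved_form fst_d_part)
  ultimately show ?thesis by (simp add: poly_sat_p_part[of v d])
qed

lemma fst_add_bounds:
  assumes "fst k \<noteq> 0" "fst k' \<noteq> 0"
  shows "fst (add_bounds k k') \<noteq> 0"
proof -
  obtain \<alpha> \<beta> \<gamma> r \<alpha>' \<beta>' \<gamma>' r' where "k = (\<alpha>, (\<beta>, \<gamma>), r)" "k' = (\<alpha>', (\<beta>', \<gamma>'), r')"
    by (metis prod.exhaust)
  then show ?thesis using assms by (auto simp: add_bounds_def)
qed

lemma poly_sat_dot:
  fixes C C' :: "'p::finite poly"
  assumes "tight C" "tight C'"
  shows "poly_sat v d (poly_dot C C') \<longleftrightarrow>
    (\<exists>d1 d2. d = d1 + d2 \<and> poly_sat v d1 C \<and> poly_sat v d2 C')"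
proof (cases "poly_sat v 0 (p_part C) \<and> poly_sat v 0 (p_part C')")
  case True
  then obtain a b where ab: "poly_sat v a C" "poly_sat v b C'"
    using assms unfolding tight_def by blast
  have "poly_sat v d (poly_dot C C') \<longleftrightarrow> (\<forall>k\<in>set (d_part C). \<forall>k'\<in>set (d_part C').
      same_direction (d_rel k) (d_rel k') \<longrightarrow> ineq_holds v d (add_bounds k k'))"
    using True by (auto simp: poly_dot_def poly_sat_p_part[of v d])
      (auto simp: poly_sat_def split: if_splits)
  also have "\<dots> \<longleftrightarrow> (\<forall>k\<in>set (d_part C). \<forall>k'\<in>set (d_part C').
      same_direction (d_rel k) (d_rel k') \<longrightarrow>
      holds (join_rel (d_rel k) (d_rel k')) d (d_bound v k + d_bound v k'))"
    by (intro ball_cong refl imp_cong add_bounds_correct fst_d_part)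
  also have "\<dots> \<longleftrightarrow> (\<forall>(r, c)\<in>d_bounds v C. \<forall>(r', c')\<in>d_bounds v C'.
      same_direction r r' \<longrightarrow> holds (join_rel r r') d (c + c'))"
    by (simp add: d_bounds_def)
  also have "\<dots> \<longleftrightarrow> (\<exists>a b. d = a + b \<and> (\<forall>(r, c)\<in>d_bounds v C. holds r a c) \<and>
      (\<forall>(r, c)\<in>d_bounds v C'. holds r b c))"
    by (rule bounds_sum[OF _ _ poly_sat_split[THEN iffD1, OF ab(1), THEN conjunct2]
          poly_sat_split[THEN iffD1, OF ab(2), THEN conjunct2]]) (simp_all add: d_bounds_def)
  finally show ?thesis using True by (simp add: poly_sat_split[of _ _ C] poly_sat_split[of _ _ C'])
next
  case False
  then show ?thesis
    by (auto simp: poly_dot_def poly_sat_p_part[of v d] poly_sat_split[of _ _ C]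
        poly_sat_split[of _ _ C'])
qed

text \<open>The sum of a point of \<open>C\<close> and a point of \<open>C'\<close> at the same
  valuation lies in the dot. This invariant allows exactness to be iterated through an
  expression.\<close>

lemma tight_dot:
  assumes "tight C" "tight C'"
  shows "tight (poly_dot C C')"
  unfolding tight_def
proof (intro allI impI)
  fix v assume "poly_sat v 0 (p_part (poly_dot C C'))"
  then have "poly_sat v 0 (p_part C)" "poly_sat v 0 (p_part C')"
    by (auto simp: poly_dot_def p_part_def poly_sat_def)
  then show "\<exists>d. poly_sat v d (poly_dot C C')"
    using assms unfolding poly_sat_dot[OF assms] unfolding tight_def by blast
qed


section \<open>Regular expressions over zones\<close>

fun word_zone :: "(('p \<Rightarrow> nat) \<times> real) set list \<Rightarrow> (('p \<Rightarrow> nat) \<times> real) set" where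
  "word_zone [] = {(v, 0) |v. True}"
| "word_zone (S # u) = {(v, d + d') |v d d'. (v, d) \<in> S \<and> (v, d') \<in> word_zone u}"

lemma word_zone_append:
  "(v, d) \<in> word_zone (u @ u') \<longleftrightarrow>
   (\<exists>d1 d2. d = d1 + d2 \<and> (v, d1) \<in> word_zone u \<and> (v, d2) \<in> word_zone u')"
proof (induction u arbitrary: d)
  case (Cons S u)
  show ?case
  proof
    assume "(v, d) \<in> word_zone ((S # u) @ u')"
    then obtain a d1 d2 where "d = a + (d1 + d2)" "(v, a) \<in> S"
      "(v, d1) \<in> word_zone u" "(v, d2) \<in> word_zone u'"
      by (auto simp: Cons.IH)
    then show "\<exists>d1 d2. d = d1 + d2 \<and> (v, d1) \<in> word_zone (S # u) \<and> (v, d2) \<in> word_zone u'"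
      by (intro exI[of _ "a + d1"] exI[of _ d2]) auto
  next
    assume "\<exists>d1 d2. d = d1 + d2 \<and> (v, d1) \<in> word_zone (S # u) \<and> (v, d2) \<in> word_zone u'"
    then obtain a d1 d2 where d: "d = a + (d1 + d2)" "(v, a) \<in> S"
      "(v, d1) \<in> word_zone u" "(v, d2) \<in> word_zone u'"
      by (auto simp: add.assoc)
    then have "(v, d1 + d2) \<in> word_zone (u @ u')" using Cons.IH by blast
    with d(1,2) show "(v, d) \<in> word_zone ((S # u) @ u')"
      unfolding append_Cons word_zone.simps by blast
  qed
qed simp

inductive word_poly :: "('b \<Rightarrow> 'p polys) \<Rightarrow> 'b list \<Rightarrow> 'p poly \<Rightarrow> bool" for rep where
  unit: "C \<in> polys_unit \<Longrightarrow> word_poly rep [] C"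
| atom: "C \<in> rep b \<Longrightarrow> word_poly rep [b] C"
| dot: "word_poly rep u C \<Longrightarrow> word_poly rep u' C' \<Longrightarrow> word_poly rep (u @ u') (poly_dot C C')"

lemma polys_dot_power_word_poly:
  assumes "\<And>C. C \<in> Z \<Longrightarrow> \<exists>u\<in>L. word_poly rep u C"
    and "C \<in> ((\<lambda>Y. polys_dot Y Z) ^^ K) polys_unit"
  shows "\<exists>us. set us \<subseteq> L \<and> word_poly rep (concat us) C"
  using assms(2)
proof (induction K arbitrary: C)
  case 0
  then show ?case by (intro exI[of _ "[]"]) (auto intro: word_poly.unit)
next
  case (Suc K)
  then obtain C1 C2 where C: "C = poly_dot C1 C2"
    "C1 \<in> ((\<lambda>Y. polys_dot Y Z) ^^ K) polys_unit" "C2 \<in> Z" by (auto simp: polys_dot_def)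
  obtain us u where "set us \<subseteq> L" "word_poly rep (concat us) C1" "u \<in> L" "word_poly rep u C2"
    using Suc.IH[OF C(2)] assms(1)[OF C(3)] by blast
  then show ?case
    by (intro exI[of _ "us @ [u]"]) (auto simp: C(1) intro: word_poly.dot)
qed

lemma zone_expr_word_poly:
  "C \<in> zone_expr rep e \<Longrightarrow> \<exists>u\<in>lang e. word_poly rep u C"
proof (induction e arbitrary: C)
  case (Times r s)
  then obtain C1 C2 where "C = poly_dot C1 C2" "C1 \<in> zone_expr rep r" "C2 \<in> zone_expr rep s"
    by (auto simp: polys_dot_def)
  with Times.IH show ?case by simp (metis word_poly.dot)
next
  case (Star r)
  then obtain K where "C \<in> ((\<lambda>Y. polys_dot Y (zone_expr rep r)) ^^ K) polys_unit"
    by (auto simp: polys_star_def)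
  from polys_dot_power_word_poly[OF Star.IH this] show ?case by auto
qed (auto intro: word_poly.intros)

lemma poly_sat_unit: "C \<in> polys_unit \<Longrightarrow> poly_sat v d C \<longleftrightarrow> d = 0"
  by (simp add: polys_unit_def poly_sat_def lin_val_def)

lemma tight_unit: "C \<in> polys_unit \<Longrightarrow> tight C"
  by (simp add: tight_def poly_sat_unit)

lemma polys_sem_iff: "(v, d) \<in> polys_sem Z \<longleftrightarrow> (\<exists>C\<in>Z. poly_sat v d C)"
  by (simp add: polys_sem_def poly_sat_def)

lemma word_poly_sound:
  assumes "word_poly rep u C" "\<And>b. b \<in> set u \<Longrightarrow> represents (rep b) b"
  shows "tight C \<and> (poly_sat v d C \<longrightarrow> (v, d) \<in> word_zone u)"
  using assms
proof (induction arbitrary: d rule: word_poly.induct)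
  case (unit C)
  then show ?case by (simp add: tight_unit poly_sat_unit)
next
  case (atom C b)
  then show ?case using polys_sem_iff[of v d "rep b"] by (auto simp: represents_iff)
next
  case (dot u C u' C')
  then have IH: "tight C" "\<And>d. poly_sat v d C \<Longrightarrow> (v, d) \<in> word_zone u"
    "tight C'" "\<And>d. poly_sat v d C' \<Longrightarrow> (v, d) \<in> word_zone u'"
    by auto
  then show ?case
    unfolding poly_sat_dot[OF IH(1,3)] word_zone_append using tight_dot by blast
qed

text \<open>Tightness is part of the claim, since it is what makes the dot exact.\<close>

lemma zone_expr_complete:
  assumes "u \<in> lang e" "(v, d) \<in> word_zone u" "\<And>b. b \<in> set u \<Longrightarrow> represents (rep b) b"
  shows "\<exists>C\<in>zone_expr rep e. tight C \<and> poly_sat v d C"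
  using assms
proof (induction e arbitrary: u d)
  case (Atom b)
  then have "(v, d) \<in> polys_sem (rep b)" "\<forall>C\<in>rep b. tight C" by (auto simp: represents_iff)
  then show ?case by (auto simp: polys_sem_iff)
next
  case (Plus r s)
  from Plus.prems(1) consider "u \<in> lang r" | "u \<in> lang s" by auto
  then show ?case using Plus.IH Plus.prems(2,3) by cases fastforce+
next
  case (Times r s)
  then obtain u1 u2 where u: "u = u1 @ u2" "u1 \<in> lang r" "u2 \<in> lang s" by auto
  obtain d1 d2 where d: "d = d1 + d2" "(v, d1) \<in> word_zone u1" "(v, d2) \<in> word_zone u2"
    using Times.prems(2) unfolding u(1) word_zone_append by blast
  obtain C1 where C1: "C1 \<in> zone_expr rep r" "tight C1" "poly_sat v d1 C1"
    using Times.IH(1)[OF u(2) d(2)] Times.prems(3) u(1) by auto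
  obtain C2 where C2: "C2 \<in> zone_expr rep s" "tight C2" "poly_sat v d2 C2"
    using Times.IH(2)[OF u(3) d(3)] Times.prems(3) u(1) by auto
  have "poly_dot C1 C2 \<in> zone_expr rep (Times r s)" using C1 C2 by (auto simp: polys_dot_def)
  moreover have "poly_sat v d (poly_dot C1 C2)"
    using C1 C2 d(1) by (auto simp: poly_sat_dot)
  ultimately show ?case using tight_dot C1(2) C2(2) by blast
next
  case (Star r)
  then obtain us where us: "u = concat us" "set us \<subseteq> lang r" by auto
  define K where "K n = ((\<lambda>Y. polys_dot Y (zone_expr rep r)) ^^ n) polys_unit" for n
  have "\<exists>n. \<exists>C\<in>K n. tight C \<and> poly_sat v d C"
    using us(2) Star.prems(2,3) unfolding us(1)
  \<comment> \<open>The powers in \<open>polys_star\<close> add their factors on the right, so the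
    last word is split off.\<close>
  proof (induction us arbitrary: d rule: rev_induct)
    case Nil
    have "\<exists>C\<in>K 0. tight C \<and> poly_sat v d C"
      using Nil by (auto simp: K_def polys_unit_def tight_unit poly_sat_unit)
    then show ?case ..
  next
    case (snoc w us)
    obtain d1 d2 where d: "d = d1 + d2" "(v, d1) \<in> word_zone (concat us)" "(v, d2) \<in> word_zone w"
      using snoc.prems(2) by (auto simp: word_zone_append)
    obtain n C1 where C1: "C1 \<in> K n" "tight C1" "poly_sat v d1 C1"
      using snoc.IH[OF _ d(2)] snoc.prems(1,3) by auto
    obtain C2 where C2: "C2 \<in> zone_expr rep r" "tight C2" "poly_sat v d2 C2"
      using Star.IH[OF _ d(3)] snoc.prems(1,3) by auto
    have "poly_dot C1 C2 \<in> K (Suc n)" using C1 C2 by (auto simp: K_def polys_dot_def)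
    moreover have "poly_sat v d (poly_dot C1 C2)"
      using C1 C2 d(1) by (auto simp: poly_sat_dot)
    ultimately show ?case using tight_dot C1(2) C2(2) by blast
  qed
  then show ?case by (auto simp: K_def polys_star_def)
next
  case Zero
  then show ?case by simp
next
  case One
  then show ?case by (auto simp: polys_unit_def tight_unit poly_sat_unit)
qed

text \<open>Both inclusions pass through single words because \<open>rep\<close> is controlled only
  on letters of words in \<open>lang e\<close>. The expression may contain other atoms, for instance
  in a product with \<open>Zero\<close>, so its subexpressions cannot be evaluated set by
  set.\<close>

lemma polys_sem_zone_expr:
  assumes "\<And>u b. u \<in> lang e \<Longrightarrow> b \<in> set u \<Longrightarrow> represents (rep b) b"
  shows "polys_sem (zone_expr rep e) = (\<Union>u\<in>lang e. word_zone u)"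
proof -
  have "(v, d) \<in> polys_sem (zone_expr rep e) \<longleftrightarrow> (\<exists>u\<in>lang e. (v, d) \<in> word_zone u)" for v d
  proof
    assume "(v, d) \<in> polys_sem (zone_expr rep e)"
    then obtain C where "C \<in> zone_expr rep e" "poly_sat v d C" by (auto simp: polys_sem_iff)
    then show "\<exists>u\<in>lang e. (v, d) \<in> word_zone u"
      using zone_expr_word_poly word_poly_sound assms by metis
  next
    assume "\<exists>u\<in>lang e. (v, d) \<in> word_zone u"
    then show "(v, d) \<in> polys_sem (zone_expr rep e)"
      using zone_expr_complete assms by (metis polys_sem_iff)
  qed
  then show ?thesis by auto
qed

section \<open>Runs as inductive predicates\<close>

text \<open>One notion for both kinds of runs: \<open>P\<close> constrains every location that is
  left, which expresses the first visit to the final location in \<open>PET\<close>, and is trivial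
  for reachability in the reset-free automaton.\<close>

inductive run_to :: "('a, 'l, 'x, 'p::finite) pta \<Rightarrow> ('p \<Rightarrow> real) \<Rightarrow> ('l \<Rightarrow> bool) \<Rightarrow> 'l \<Rightarrow>
    ('l, 'x) state \<Rightarrow> real \<Rightarrow> bool" for A w P f where
  stop: "fst s = f \<Longrightarrow> run_to A w P f s 0"
| step: "P (fst s) \<Longrightarrow> step A w s (\<delta>, E) s' \<Longrightarrow> run_to A w P f s' d \<Longrightarrow> run_to A w P f s (\<delta> + d)"

lemma run_to_iff:
  "run_to A w P f s d \<longleftrightarrow> (\<exists>ss es. length ss = Suc (length es) \<and> ss ! 0 = s \<and>
     (\<forall>i<length es. step A w (ss ! i) (es ! i) (ss ! Suc i)) \<and> duration es = d \<and>
     fst (ss ! length es) = f \<and> (\<forall>i<length es. P (fst (ss ! i))))"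
    (is "_ \<longleftrightarrow> (\<exists>ss es. ?Q s d ss es)")
proof
  assume "run_to A w P f s d"
  then show "\<exists>ss es. ?Q s d ss es"
  proof induction
    case (stop s)
    then show ?case by (intro exI[of _ "[s]"] exI[of _ "[]"]) (simp add: duration_def)
  next
    case (step s \<delta> E s' d)
    then obtain ss es where Q: "?Q s' d ss es" by blast
    have "step A w ((s # ss) ! i) (((\<delta>, E) # es) ! i) ((s # ss) ! Suc i)" "P (fst ((s # ss) ! i))"
      if "i < Suc (length es)" for i
      using that Q step.hyps by (cases i; simp)+
    moreover have "duration ((\<delta>, E) # es) = \<delta> + d"
      using Q by (simp add: duration_def sum.lessThan_Suc_shift del: sum.lessThan_Suc)
    ultimately show ?case using Q by (intro exI[of _ "s # ss"] exI[of _ "(\<delta>, E) # es"]) simp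
  qed
next
  assume "\<exists>ss es. ?Q s d ss es"
  then obtain ss es where "?Q s d ss es" by blast
  then show "run_to A w P f s d"
  proof (induction es arbitrary: ss s d)
    case Nil
    then show ?case by (auto simp: duration_def intro: run_to.stop)
  next
    case (Cons e es)
    obtain \<delta> E where e: "e = (\<delta>, E)" by (cases e)
    obtain ss' where ss: "ss = s # ss'" using Cons.prems by (cases ss) auto
    have d: "d = \<delta> + duration es"
      using Cons.prems by (simp add: duration_def sum.lessThan_Suc_shift e del: sum.lessThan_Suc)
    have all: "step A w (ss ! i) ((e # es) ! i) (ss ! Suc i)" "P (fst (ss ! i))"
      if "i < Suc (length es)" for i
      using Cons.prems that by auto
    have "run_to A w P f (ss' ! 0) (duration es)"
      by (rule Cons.IH[of ss']) (use Cons.prems all[of "Suc _"] in \<open>auto simp: ss\<close>)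
    moreover have "P (fst s)" "step A w s (\<delta>, E) (ss' ! 0)"
      using all[of 0] by (auto simp: ss e)
    ultimately show ?case unfolding d by (rule run_to.step[rotated 2])
  qed
qed

lemma run_to_TrueI:
  "fst s = f \<Longrightarrow> \<exists>D. run_to A w (\<lambda>_. True) f s D"
  "step A w s (\<delta>, E) s' \<Longrightarrow> \<exists>D. run_to A w (\<lambda>_. True) f s' D \<Longrightarrow>
    \<exists>D. run_to A w (\<lambda>_. True) f s D"
  by (blast intro: run_to.stop, erule exE, rule exI, rule run_to.step[OF TrueI])

lemma PET_iff: "(v, d) \<in> PET A \<longleftrightarrow>
  run_to A (\<lambda>p. real (v p)) (\<lambda>l. l \<noteq> final_loc A) (final_loc A) (init_state A) d"
  by (simp add: PET_def run_to_iff is_run_def conj_assoc)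

lemma zone_iff: "(v, d) \<in> zone A x i j \<longleftrightarrow> d \<ge> 0 \<and>
  (\<exists>D. run_to (reset_free A x i j) (with_dur v d) (\<lambda>_. True) (Some j)
     (init_state (reset_free A x i j)) D)"
proof -
  have "with_dur v d = with_dur v' d' \<Longrightarrow> d = d'" for v' d'
    by (drule fun_cong[where x = None]) (simp add: with_dur_def)
  then show ?thesis
    by (auto simp: zone_def EFsynth_def run_to_iff is_run_def conj_assoc)
qed


section \<open>Segments between resets\<close>

text \<open>The conditions of a step that concern its source and guard, isolated so that they
  transfer between an automaton and its reset-free copy. With one clock every valuation is constant
  and is given by the number \<open>c\<close>.\<close>

definition delay_ok :: "('a, 'l, 'x, 'p::finite) pta \<Rightarrow> ('p \<Rightarrow> real) \<Rightarrow> 'l \<Rightarrow> real \<Rightarrow> real \<Rightarrow>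
    ('x, 'p) guard \<Rightarrow> bool" where
  "delay_ok A w l c \<delta> g \<longleftrightarrow> \<delta> \<ge> 0 \<and> (l \<in> urgent A \<longrightarrow> \<delta> = 0) \<and>
     (\<forall>t. 0 \<le> t \<and> t \<le> \<delta> \<longrightarrow> sat w (\<lambda>_. c + t) (inv A l)) \<and> sat w (\<lambda>_. c + \<delta>) g"

lemma step_delay_ok:
  assumes "(UNIV :: 'x set) = {x}"
  shows "step A w (l, \<lambda>_ :: 'x. c) (\<delta>, E) s' \<longleftrightarrow> (\<exists>g a R l'. E = (l, g, a, R, l') \<and>
    E \<in> edges A \<and> delay_ok A w l c \<delta> g \<and>
    (let c' = if R = {} then c + \<delta> else 0 in s' = (l', \<lambda>_. c') \<and> sat w (\<lambda>_. c') (inv A l')))"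
proof -
  have "(\<lambda>y. if y \<in> R then 0 else c + \<delta>) = (\<lambda>_. if R = {} then c + \<delta> else 0)" for R :: "'x set"
  proof -
    have "y = x" for y using assms by blast
    then have "R = {} \<or> R = UNIV" by (metis UNIV_eq_I empty_iff equals0I)
    then show ?thesis by auto
  qed
  then show ?thesis
    by (cases E; cases s') (auto simp: delay_ok_def Let_def)
qed

text \<open>The invariant of \<open>j\<close> after a reset is not required; instead, its lower bounds are required for
  the clock value before the reset, as in the reset-free automaton.\<close>

inductive segment :: "('a, 'l, 'x, 'p::finite) pta \<Rightarrow> ('p \<Rightarrow> real) \<Rightarrow> 'l \<Rightarrow> 'l \<Rightarrow> real \<Rightarrow> real \<Rightarrow> bool"
  for A w j where
  enter_reset: "l \<noteq> final_loc A \<Longrightarrow> (l, g, a, R, j) \<in> edges A \<Longrightarrow> R \<noteq> {} \<Longrightarrow>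
    delay_ok A w l c \<delta> g \<Longrightarrow> sat w (\<lambda>_. c + \<delta>) (drop_upper (inv A j)) \<Longrightarrow>
    segment A w j l c (c + \<delta>)"
| enter_final: "l \<noteq> final_loc A \<Longrightarrow> (l, g, a, {}, j) \<in> edges A \<Longrightarrow> j = final_loc A \<Longrightarrow>
    delay_ok A w l c \<delta> g \<Longrightarrow> sat w (\<lambda>_. c + \<delta>) (inv A j) \<Longrightarrow>
    segment A w j l c (c + \<delta>)"
| move: "l \<noteq> final_loc A \<Longrightarrow> (l, g, a, {}, l') \<in> edges A \<Longrightarrow>
    delay_ok A w l c \<delta> g \<Longrightarrow> sat w (\<lambda>_. c + \<delta>) (inv A l') \<Longrightarrow>
    segment A w j l' (c + \<delta>) d \<Longrightarrow> segment A w j l c d"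

lemma segment_props: "segment A w j l c d \<Longrightarrow> l \<noteq> final_loc A \<and> c \<le> d \<and> (j = final_loc A \<or> reset_into A j)"
  by (induction rule: segment.induct) (auto simp: delay_ok_def reset_into_def)

section \<open>Guards, edges and invariants of the reset-free automaton\<close>

lemma sat_lift_guard [simp]: "sat (with_dur v d) \<mu> (lift_guard g) \<longleftrightarrow> sat (\<lambda>p. real (v p)) \<mu> g"
proof -
  have "lin_val (with_dur v d) (lift_lin t) = lin_val (\<lambda>p. real (v p)) t" for t
    by (cases t) (simp add: lin_val_def with_dur_def UNIV_option_conv sum.reindex)
  then show ?thesis by (auto simp: sat_def lift_guard_def)
qed

lemma sat_dur [simp]:
  "sat (with_dur v d) \<mu> ((x, Eq, dur) # g) \<longleftrightarrow> \<mu> x = d \<and> sat (with_dur v d) \<mu> g"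
  by (simp add: sat_def lin_val_dur)

text \<open>Lower bounds survive an increase of the clock. Hence an invariant that holds at 0 after
  a reset implies what the reset-free automaton tests at the value before it.\<close>

lemma sat_drop_upper:
  assumes "sat w \<mu> g" "\<And>y. \<mu> y \<le> \<nu> y"
  shows "sat w \<nu> (drop_upper g)"
  using assms(1)
proof (induction g rule: drop_upper.induct)
  case (2 y r t g)
  then show ?case using assms(2)[of y] by (cases r) (auto simp: sat_def)
qed (simp add: sat_def)

text \<open>The location of the reset-free automaton from which the outgoing edges of \<open>l\<close> leave.\<close>

definition dup :: "'l \<Rightarrow> 'l \<Rightarrow> 'l option" where
  "dup j l = (if l = j then None else Some l)"

lemma dup_neq [simp]: "dup j l \<noteq> Some j"
  by (simp add: dup_def)

lemma dup_inj [simp]: "dup j l = dup j l' \<longleftrightarrow> l = l'"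
  by (simp add: dup_def)

text \<open>The chain of edge transformations leaves three kinds of edges: copies of edges without
  reset, copies of resetting edges into \<open>j\<close>, and the silent edge. Sources have the form
  \<open>dup j l\<close> even for final \<open>j\<close>, where outgoing edges are not redirected:
  the edges for which this would differ leave the final location and are pruned.\<close>

lemma reset_free_edges_iff:
  fixes A :: "('a, 'l, 'x, 'p::finite) pta"
  shows
  "(L, g, a, R, L') \<in> edges (reset_free A x i j) \<longleftrightarrow> R = {} \<and>
    ((\<exists>l g0 a0 l'. (l, g0, a0, {}, l') \<in> edges A \<and> l \<noteq> final_loc A \<and>
        L = dup j l \<and> g = lift_guard g0 \<and> a = Some a0 \<and> L' = dup j l') \<or>
     (\<exists>l g0 a0 R0. (l, g0, a0, R0, j) \<in> edges A \<and> R0 \<noteq> {} \<and> l \<noteq> final_loc A \<and>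
        L = dup j l \<and> g = (x, Eq, dur) # lift_guard g0 \<and> a = Some a0 \<and> L' = Some j) \<or>
     (j = final_loc A \<and> L = None \<and> g = [(x, Eq, dur)] \<and> a = None \<and> L' = Some j))"
  (is "?e \<in> _ \<longleftrightarrow> ?rhs")
proof -
  let ?F = "final_loc A"
  define ok :: "('a, 'l, 'x, 'p) aux_edge \<Rightarrow> bool"
    where "ok = (\<lambda>(l, g, a, R, l'). R = {} \<and> l \<noteq> Some ?F)"
  define X :: "('a, 'l, 'x, 'p) aux_edge \<Rightarrow> ('a, 'l, 'x, 'p) aux_edge"
    where "X = (if j \<noteq> ?F then redirect_out j else (\<lambda>E. E))"
  define tr :: "('a, 'l, 'x, 'p) edge \<Rightarrow> ('a, 'l, 'x, 'p) aux_edge" where "tr = (\<lambda>(l, g, a, R, l').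
     (if j \<noteq> ?F then dup j l else Some l,
      if l' = j \<and> R \<noteq> {} then (x, Eq, dur) # lift_guard g else lift_guard g, Some a,
      if l' = j then {} else R, if l' = j \<and> R = {} then None else Some l'))"
  have tr: "guard_in x j (unreset_in j (X (redirect_in j (copy_edge E)))) = tr E" for E
    by (cases E) (auto simp: tr_def X_def dup_def)
  define E3 where "E3 = (\<lambda>E. X (redirect_in j (copy_edge E))) ` edges A \<union>
    (if j = ?F then {(None, [], None, {}, Some j)} else {})"
  have ok: "ok (guard_in x j E) = ok E" for E
    by (cases E) (simp add: ok_def)
  have collect: "{(l, g, a, R, l') \<in> S. R = {} \<and> l \<noteq> Some ?F} = {E \<in> S. ok E}"
    for S :: "('a, 'l, 'x, 'p) aux_edge set"
    by (auto simp: ok_def)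
  have "edges (reset_free A x i j) = guard_in x j ` {E \<in> unreset_in j ` E3. ok E}"
    unfolding reset_free_def reset_free_edges_def Let_def pta.simps collect E3_def X_def
    by (cases "j = ?F") (simp_all add: image_image)
  also have "\<dots> = {E \<in> guard_in x j ` unreset_in j ` E3. ok E}"
    using ok by blast
  also have "guard_in x j ` unreset_in j ` E3 =
      tr ` edges A \<union> (if j = ?F then {(None, [(x, Eq, dur)], None, {}, Some j)} else {})"
    unfolding E3_def image_Un image_image tr by auto
  finally have "?e \<in> edges (reset_free A x i j) \<longleftrightarrow> ok ?e \<and>
      ((\<exists>E\<in>edges A. ?e = tr E) \<or> j = ?F \<and> ?e = (None, [(x, Eq, dur)], None, {}, Some j))"
    by (auto split: if_splits)
  then have *: "?e \<in> edges (reset_free A x i j) \<longleftrightarrow> ok ?e \<and>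
      ((\<exists>l g0 a0 R0 l'. (l, g0, a0, R0, l') \<in> edges A \<and> ?e = tr (l, g0, a0, R0, l')) \<or>
       j = ?F \<and> ?e = (None, [(x, Eq, dur)], None, {}, Some j))"
    by (simp add: Bex_def split_paired_Ex)
  have K: "ok ?e \<and> ?e = tr (l, g0, a0, R0, l') \<longleftrightarrow> R = {} \<and> l \<noteq> ?F \<and> L = dup j l \<and> a = Some a0 \<and>
      (R0 = {} \<and> g = lift_guard g0 \<and> L' = dup j l' \<or>
       R0 \<noteq> {} \<and> l' = j \<and> g = (x, Eq, dur) # lift_guard g0 \<and> L' = Some j)" for l g0 a0 R0 l'
    by (auto simp: ok_def tr_def dup_def)
  have N: "ok ?e \<and> ?e = (None, [(x, Eq, dur)], None, {}, Some j) \<longleftrightarrow>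
      R = {} \<and> L = None \<and> g = [(x, Eq, dur)] \<and> a = None \<and> L' = Some j"
    by (auto simp: ok_def)
  have "?e \<in> edges (reset_free A x i j) \<longleftrightarrow>
      (\<exists>l g0 a0 R0 l'. (l, g0, a0, R0, l') \<in> edges A \<and> ok ?e \<and> ?e = tr (l, g0, a0, R0, l')) \<or>
      j = ?F \<and> ok ?e \<and> ?e = (None, [(x, Eq, dur)], None, {}, Some j)"
    unfolding * by (simp only: conj_disj_distribL ex_simps conj_left_commute)
  also have "\<dots> \<longleftrightarrow> ?rhs"
    unfolding K N by blast
  finally show ?thesis .
qed

lemma init_reset_free [simp]: "init_loc (reset_free A x i j) = dup j i"
  by (simp add: reset_free_def dup_def)

lemma inv_dup [simp]: "inv (reset_free A x i j) (dup j l) = lift_guard (inv A l)"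
  by (simp add: reset_free_def dup_def)

lemma inv_None [simp]: "inv (reset_free A x i j) None = lift_guard (inv A j)"
  by (simp add: reset_free_def)

lemma inv_target [simp]: "inv (reset_free A x i j) (Some j) = lift_guard (drop_upper (inv A j))"
  by (simp add: reset_free_def)

lemma urgent_dup [simp]:
  "dup j l \<in> urgent (reset_free A x i j) \<longleftrightarrow> l \<in> urgent A \<or> l = j \<and> j = final_loc A"
  by (auto simp: reset_free_def dup_def)

lemma reset_free_segment:
  fixes A :: "('a, 'l, 'x, 'p::finite) pta"
  assumes x: "(UNIV :: 'x set) = {x}" and l: "l \<noteq> final_loc A"
  shows "(\<exists>D. run_to (reset_free A x i j) (with_dur v d) (\<lambda>_. True) (Some j) (dup j l, \<lambda>_. c) D) \<longleftrightarrow>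
    segment A (\<lambda>p. real (v p)) j l c d"
proof
  let ?B = "reset_free A x i j" and ?w = "with_dur v d" and ?v = "\<lambda>p. real (v p)"
  assume "\<exists>D. run_to ?B ?w (\<lambda>_. True) (Some j) (dup j l, \<lambda>_. c) D"
  then obtain D where "run_to ?B ?w (\<lambda>_. True) (Some j) (dup j l, \<lambda>_. c) D" ..
  \<comment> \<open>The second conjunct treats the duplicate of a final \<open>j\<close>. It is
    urgent, and the silent edge guarded by \<open>x = d\<close> is its only way out, so the clock
    already equals \<open>d\<close> on arrival.\<close>
  moreover have "(\<forall>l c. s = (dup j l, \<lambda>_. c) \<longrightarrow> l \<noteq> final_loc A \<longrightarrow> segment A ?v j l c d) \<and>
      (\<forall>c. s = (None, \<lambda>_. c) \<longrightarrow> j = final_loc A \<longrightarrow> c = d)"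
    if "run_to ?B ?w (\<lambda>_. True) (Some j) s D" for s D
    using that
  proof induction
    case (stop s)
    then show ?case by auto
  next
    case (step s \<delta> E s' D)
    show ?case
    proof (intro conjI allI impI)
      fix l c assume s: "s = (dup j l, \<lambda>_. c)" and l: "l \<noteq> final_loc A"
      from step.hyps(2) obtain g a R L' where E: "E = (dup j l, g, a, R, L')" "E \<in> edges ?B"
        and dl: "delay_ok ?B ?w (dup j l) c \<delta> g"
        and s': "let c' = if R = {} then c + \<delta> else 0
          in s' = (L', \<lambda>_. c') \<and> sat ?w (\<lambda>_. c') (inv ?B L')"
        unfolding s step_delay_ok[OF x] by blast
      have R: "R = {}" using E by (auto simp: reset_free_edges_iff)
      with s' have s': "s' = (L', \<lambda>_. c + \<delta>)" "sat ?w (\<lambda>_. c + \<delta>) (inv ?B L')" by (auto simp: Let_def)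
      from E l consider (inner) g0 a0 l' where "(l, g0, a0, {}, l') \<in> edges A"
          "g = lift_guard g0" "L' = dup j l'"
        | (reset) g0 a0 R0 where "(l, g0, a0, R0, j) \<in> edges A" "R0 \<noteq> {}"
          "g = (x, Eq, dur) # lift_guard g0" "L' = Some j"
        by (auto simp: reset_free_edges_iff dup_def split: if_splits)
      then show "segment A ?v j l c d"
      proof cases
        case inner
        have dl: "delay_ok A ?v l c \<delta> g0" using dl l by (simp add: delay_ok_def inner)
        have iv: "sat ?v (\<lambda>_. c + \<delta>) (inv A l')" using s'(2) by (simp add: inner)
        show ?thesis
        proof (cases "l' = final_loc A")
          case True
          \<comment> \<open>Any other final location would be a dead end: it is not the target, and
            its outgoing edges are pruned.\<close>
          have f: "j = l'"
          proof (rule ccontr)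
            assume "j \<noteq> l'"
            show False using step.hyps(3)
            proof cases
              case stop
              then show False using s' inner by simp
            next
              case (step \<delta>' E' s'' d')
              have "step ?B ?w s' (\<delta>', E') s''" by fact
              then have "\<exists>g a R L. (dup j l', g, a, R, L) \<in> edges ?B"
                unfolding s'(1) inner step_delay_ok[OF x] by blast
              then show False using \<open>j \<noteq> l'\<close> True
                by (auto simp: reset_free_edges_iff dup_def split: if_splits)
            qed
          qed
          then have "c + \<delta> = d" using step.IH True s'(1) inner by (auto simp: dup_def)
          then show ?thesis
            using segment.enter_final[OF l _ _ dl, of a0 j] inner iv f True by auto
        next
          case False
          then have "segment A ?v j l' (c + \<delta>) d" using step.IH s'(1) inner by blast
          then show ?thesis using segment.move[OF l _ dl iv] inner by blast
        qed
      next
        case reset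
        have dl': "delay_ok A ?v l c \<delta> g0" and d: "c + \<delta> = d"
          using dl l by (auto simp: delay_ok_def reset)
        have "sat ?v (\<lambda>_. c + \<delta>) (drop_upper (inv A j))" using s'(2) by (simp add: reset)
        from segment.enter_reset[OF l reset(1,2) dl' this] show ?thesis by (simp add: d)
      qed
    next
      fix c assume s: "s = (None, \<lambda>_. c)" and j: "j = final_loc A"
      have N: "(None :: 'l option) = dup j j" by (simp add: dup_def)
      from step.hyps(2) obtain g a R L' where E: "E = (dup j j, g, a, R, L')" "E \<in> edges ?B"
        and dl: "delay_ok ?B ?w (dup j j) c \<delta> g"
        unfolding s N step_delay_ok[OF x] by blast
      have "g = [(x, Eq, dur)]" using E j by (auto simp: reset_free_edges_iff)
      moreover have "\<delta> = 0" using dl j by (simp add: delay_ok_def)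
      ultimately show "c = d" using dl by (simp add: delay_ok_def)
    qed
  qed
  ultimately show "segment A ?v j l c d" using l by blast
next
  let ?B = "reset_free A x i j" and ?w = "with_dur v d" and ?v = "\<lambda>p. real (v p)"
  let ?r = "run_to ?B ?w (\<lambda>_. True) (Some j)"
  \<comment> \<open>\<open>d\<close> also occurs in the valuation \<open>?w\<close>, which has to
    stay fixed during the induction; hence the separate index \<open>d'\<close>.\<close>
  have "\<exists>D. ?r (dup j l, \<lambda>_. c) D" if "segment A ?v j l c d'" "d' = d" for d'
    using that
  proof induction
    case (enter_reset l g a R c \<delta>)
    have "step ?B ?w (dup j l, \<lambda>_. c)
        (\<delta>, (dup j l, (x, Eq, dur) # lift_guard g, Some a, {}, Some j)) (Some j, \<lambda>_. c + \<delta>)"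
      unfolding step_delay_ok[OF x]
      using enter_reset by (auto simp: reset_free_edges_iff delay_ok_def)
    then show ?case by (rule run_to_TrueI(2)) (simp add: run_to_TrueI(1))
  next
    case (enter_final l g a c \<delta>)
    have "step ?B ?w (dup j l, \<lambda>_. c) (\<delta>, (dup j l, lift_guard g, Some a, {}, dup j j))
        (dup j j, \<lambda>_. c + \<delta>)"
      unfolding step_delay_ok[OF x]
      using enter_final by (auto simp: reset_free_edges_iff delay_ok_def)
    moreover have "step ?B ?w (dup j j, \<lambda>_. c + \<delta>)
        (0, (dup j j, [(x, Eq, dur)], None, {}, Some j)) (Some j, \<lambda>_. c + \<delta>)"
      unfolding step_delay_ok[OF x]
      using enter_final sat_drop_upper[of ?v "\<lambda>_. c + \<delta>" "inv A j"]
      by (auto simp: reset_free_edges_iff delay_ok_def dup_def[of "final_loc A" "final_loc A"] sat_def[of _ _ "[]"])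
    ultimately show ?case by (rule run_to_TrueI(2)[OF _ run_to_TrueI(2)]) (simp add: run_to_TrueI(1))
  next
    case (move l g a l' c \<delta> d')
    have "step ?B ?w (dup j l, \<lambda>_. c) (\<delta>, (dup j l, lift_guard g, Some a, {}, dup j l'))
        (dup j l', \<lambda>_. c + \<delta>)"
      unfolding step_delay_ok[OF x]
      using move by (auto simp: reset_free_edges_iff delay_ok_def)
    then show ?case using move.IH[OF move.prems] by (rule run_to_TrueI(2))
  qed
  then show "segment A ?v j l c d \<Longrightarrow> \<exists>D. ?r (dup j l, \<lambda>_. c) D" by blast
qed

lemma zone_segment:
  fixes A :: "('a, 'l, 'x, 'p::finite) pta"
  assumes "(UNIV :: 'x set) = {x}" "i \<noteq> final_loc A"
  shows "(v, d) \<in> zone A x i j \<longleftrightarrow> segment A (\<lambda>p. real (v p)) j i 0 d"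
  using reset_free_segment[OF assms, of i j v d 0] segment_props[of A _ j i 0 d]
  by (auto simp: zone_iff init_state_def)


section \<open>Paths of the automaton of the zones\<close>

abbreviation accepted_from :: "('a, 'l, 'x, 'p::finite) pta \<Rightarrow> 'x \<Rightarrow> 'l \<Rightarrow>
    (('p \<Rightarrow> nat) \<times> real) set list \<Rightarrow> bool" where
  "accepted_from A x i u \<equiv> nfa_path (nfa_trans (zone_automaton A x)) i u (final_loc A)"

abbreviation reaches_final :: "('a, 'l, 'x, 'p::finite) pta \<Rightarrow> ('p \<Rightarrow> nat) \<Rightarrow>
    ('l, 'x) state \<Rightarrow> real \<Rightarrow> bool" where
  "reaches_final A v \<equiv>
    run_to A (\<lambda>p. real (v p)) (\<lambda>l. l \<noteq> final_loc A) (final_loc A)"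

lemma zone_automaton_trans:
  "(i, S, j) \<in> nfa_trans (zone_automaton A x) \<longleftrightarrow> (i, j) \<in> FrP A \<and> S = zone A x i j"
  by (auto simp: zone_automaton_def)

text \<open>Away from the final location the run must take a step, and a step tests the invariant of
  its source from delay 0 on.\<close>

lemma reaches_final_inv:
  fixes A :: "('a, 'l, 'x, 'p::finite) pta"
  assumes x: "(UNIV :: 'x set) = {x}"
    and r: "reaches_final A v (l, \<lambda>_. c) D" and l: "l \<noteq> final_loc A"
  shows "sat (\<lambda>p. real (v p)) (\<lambda>_. c) (inv A l)"
  using r
proof cases
  case (step \<delta> E s' d)
  have "step A (\<lambda>p. real (v p)) (l, \<lambda>_. c) (\<delta>, E) s'" by fact
  then obtain g where "delay_ok A (\<lambda>p. real (v p)) l c \<delta> g"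
    unfolding step_delay_ok[OF x] by blast
  then have "0 \<le> \<delta>" "\<And>t. 0 \<le> t \<Longrightarrow> t \<le> \<delta> \<Longrightarrow> sat (\<lambda>p. real (v p)) (\<lambda>_. c + t) (inv A l)"
    by (auto simp: delay_ok_def)
  from this(2)[OF order_refl this(1)] show ?thesis by simp
qed (use l in simp)

text \<open>The segment does not check the invariant of \<open>j\<close> after the reset; the rest of the run does so,
  except if \<open>j\<close> is final.\<close>

lemma segment_reaches_final:
  fixes A :: "('a, 'l, 'x, 'p::finite) pta"
  assumes x: "(UNIV :: 'x set) = {x}"
    and final_inv: "reset_into A (final_loc A) \<Longrightarrow> sat (\<lambda>p. real (v p)) (\<lambda>_. 0) (inv A (final_loc A))"
    and rest: "if j = final_loc A then D = 0 else reaches_final A v (j, \<lambda>_. 0) D"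
    and seg: "segment A (\<lambda>p. real (v p)) j l c d"
  shows "reaches_final A v (l, \<lambda>_. c) (d - c + D)"
  using seg
proof induction
  case (enter_reset l g a R c \<delta>)
  \<comment> \<open>For final \<open>j\<close> this is the empty run, since then
    \<open>D = 0\<close>.\<close>
  have r: "reaches_final A v (j, \<lambda>_. 0) D"
    using rest by (auto intro: run_to.stop split: if_splits)
  have "reset_into A j" using enter_reset by (auto simp: reset_into_def)
  then have "sat (\<lambda>p. real (v p)) (\<lambda>_. 0) (inv A j)"
    using reaches_final_inv[OF x r] final_inv by blast
  then have "step A (\<lambda>p. real (v p)) (l, \<lambda>_. c) (\<delta>, (l, g, a, R, j)) (j, \<lambda>_. 0)"
    unfolding step_delay_ok[OF x] using enter_reset by auto
  from run_to.step[OF _ this r] enter_reset.hyps(1)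
  have "reaches_final A v (l, \<lambda>_. c) (\<delta> + D)" by simp
  then show ?case by simp
next
  case (enter_final l g a c \<delta>)
  then have st: "step A (\<lambda>p. real (v p)) (l, \<lambda>_. c) (\<delta>, (l, g, a, {}, j)) (j, \<lambda>_. c + \<delta>)"
    unfolding step_delay_ok[OF x] by auto
  have "reaches_final A v (j, \<lambda>_. c + \<delta>) 0"
    using enter_final by (intro run_to.stop) simp
  from run_to.step[OF _ st this] enter_final.hyps(1)
  have "reaches_final A v (l, \<lambda>_. c) (\<delta> + 0)" by simp
  then show ?case using enter_final rest by simp
next
  case (move l g a l' c \<delta> d)
  then have "step A (\<lambda>p. real (v p)) (l, \<lambda>_. c) (\<delta>, (l, g, a, {}, l')) (l', \<lambda>_. c + \<delta>)"
    unfolding step_delay_ok[OF x] by auto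
  from run_to.step[OF _ this move.IH] move.hyps(1)
  have "reaches_final A v (l, \<lambda>_. c) (\<delta> + (d - (c + \<delta>) + D))" by simp
  then show ?case by (simp add: algebra_simps)
qed

text \<open>The run is read from its end: a step without reset prolongs the segment that follows,
  and a step with reset turns that segment into a letter and opens a new one. The first segment
  stays outside the word because it starts at an arbitrary clock value \<open>c\<close>, whereas
  zones start at 0.\<close>

lemma reaches_final_segment:
  fixes A :: "('a, 'l, 'x, 'p::finite) pta"
  assumes x: "(UNIV :: 'x set) = {x}"
    and r: "reaches_final A v (l, \<lambda>_. c) D" and l: "l \<noteq> final_loc A" and c: "0 \<le> c"
  shows "\<exists>j d u D'. segment A (\<lambda>p. real (v p)) j l c d \<and> accepted_from A x j u \<and>
    (v, D') \<in> word_zone u \<and> D = d - c + D'"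
proof -
  let ?v = "\<lambda>p. real (v p)"
  let ?Q = "\<lambda>l c D j d u D'. segment A ?v j l c d \<and> accepted_from A x j u \<and>
    (v, D') \<in> word_zone u \<and> D = d - c + D'"
  have "\<exists>j d u D'. ?Q l c D j d u D'"
    if "reaches_final A v s D" "s = (l, \<lambda>_. c)" "l \<noteq> final_loc A" "0 \<le> c" for s l c D
    using that
  proof (induction arbitrary: l c)
    case (step s \<delta> E s' D)
    from step.hyps(2) obtain g a R l' where E: "(l, g, a, R, l') \<in> edges A"
      and dl: "delay_ok A ?v l c \<delta> g"
      and s': "s' = (l', \<lambda>_. if R = {} then c + \<delta> else 0)"
      and iv: "sat ?v (\<lambda>_. if R = {} then c + \<delta> else 0) (inv A l')"
      unfolding step.prems(1) step_delay_ok[OF x] by (auto simp: Let_def)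
    have \<delta>: "0 \<le> \<delta>" using dl by (simp add: delay_ok_def)
    have D0: "D = 0" if "l' = final_loc A"
      using step.hyps(3) by cases (use that s' in auto)
    have fin: "accepted_from A x (final_loc A) []" "(v, 0) \<in> word_zone []"
      by (auto intro: nfa_nil)
    show ?case
    proof (cases "R = {}")
      case True
      note iv = iv[unfolded True, simplified] and s' = s'[unfolded True, simplified]
        and E = E[unfolded True]
      show ?thesis
      proof (cases "l' = final_loc A")
        case l': True
        have "segment A ?v l' l c (c + \<delta>)"
          by (rule segment.enter_final[OF step.prems(2) E l' dl iv])
        then have "?Q l c (\<delta> + D) l' (c + \<delta>) [] 0" using fin D0 l' by simp
        then show ?thesis by blast
      next
        case False
        from step.IH[OF s' False add_nonneg_nonneg[OF step.prems(3) \<delta>]] obtain j d u D' where Q: "?Q l' (c + \<delta>) D j d u D'" by blast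
        then have "segment A ?v j l c d" using segment.move[OF step.prems(2) E dl iv] by blast
        with Q have "?Q l c (\<delta> + D) j d u D'" by simp
        then show ?thesis by blast
      qed
    next
      case False
      with iv s' have iv: "sat ?v (\<lambda>_. 0) (inv A l')" and s': "s' = (l', \<lambda>_. 0)" by simp_all
      have "sat ?v (\<lambda>_. c + \<delta>) (drop_upper (inv A l'))"
        by (rule sat_drop_upper[OF iv]) (use step.prems(3) \<delta> in simp)
      then have seg: "segment A ?v l' l c (c + \<delta>)"
        by (rule segment.enter_reset[OF step.prems(2) E False dl])
      show ?thesis
      proof (cases "l' = final_loc A")
        case True
        then have "?Q l c (\<delta> + D) l' (c + \<delta>) [] 0" using fin D0 seg by simp
        then show ?thesis by blast
      next
        case l': False
        from step.IH[OF s' l' order_refl] obtain j d u D' where Q: "?Q l' 0 D j d u D'" by blast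
        have "reset_into A l'" using E False by (auto simp: reset_into_def)
        with l' segment_props[of A ?v j l' 0 d] Q have "(l', j) \<in> FrP A" by (auto simp: FrP_def)
        with Q have "accepted_from A x l' (zone A x l' j # u)"
          by (auto intro: nfa_cons simp: zone_automaton_trans)
        moreover have "(v, d + D') \<in> word_zone (zone A x l' j # u)"
          using Q zone_segment[OF x l'] by auto
        ultimately have "?Q l c (\<delta> + D) l' (c + \<delta>) (zone A x l' j # u) (d + D')"
          using seg Q by simp
        then show ?thesis by blast
      qed
    qed
  qed simp
  from this[OF r refl l c] show ?thesis .
qed

text \<open>Final-reset pairs admit the final location as a source only when it is initial.\<close>

lemma accepted_from_final:
  assumes "init_loc A \<noteq> final_loc A" "accepted_from A x (final_loc A) u"
  shows "u = []"
  using assms(2) by cases (use assms(1) in \<open>auto simp: zone_automaton_trans FrP_def\<close>)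

lemma word_zone_reaches_final:
  fixes A :: "('a, 'l, 'x, 'p::finite) pta"
  assumes x: "(UNIV :: 'x set) = {x}" and init: "init_loc A \<noteq> final_loc A"
    and final_inv: "reset_into A (final_loc A) \<Longrightarrow> sat (\<lambda>p. real (v p)) (\<lambda>_. 0) (inv A (final_loc A))"
    and "accepted_from A x i u" "i \<noteq> final_loc A" "(v, D) \<in> word_zone u"
  shows "reaches_final A v (i, \<lambda>_. 0) D"
  using assms(4-)
proof (induction i u "final_loc A" arbitrary: D rule: nfa_path.induct)
  case (nfa_cons i S j u)
  then have S: "S = zone A x i j" by (simp add: zone_automaton_trans)
  obtain d D' where D: "D = d + D'" "(v, d) \<in> S" "(v, D') \<in> word_zone u"
    using nfa_cons.prems(2) by auto
  \<comment> \<open>After a letter that leads to the final location the remaining word is empty and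
    lasts 0.\<close>
  have rest: "if j = final_loc A then D' = 0 else reaches_final A v (j, \<lambda>_. 0) D'"
    using nfa_cons.hyps(2,3) D(3) accepted_from_final[OF init, of x u] by auto
  have "segment A (\<lambda>p. real (v p)) j i 0 d"
    using D(2) zone_segment[OF x nfa_cons.prems(1)] unfolding S by simp
  from segment_reaches_final[OF x final_inv rest this] show ?case by (simp add: D(1))
qed simp

text \<open>Pruning leaves the final location no way out except the silent edge from its duplicate,
  which is urgent and tests \<open>x = d\<close> at clock value 0. This settles the case of an
  initial location that is final, where words of any length may be accepted but all last 0.\<close>

lemma zone_from_final:
  fixes A :: "('a, 'l, 'x, 'p::finite) pta"
  assumes x: "(UNIV :: 'x set) = {x}" and z: "(v, d) \<in> zone A x (final_loc A) j"
  shows "j = final_loc A \<and> d = 0"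
proof -
  let ?F = "final_loc A" and ?B = "reset_free A x (final_loc A) j"
  obtain D where "run_to ?B (with_dur v d) (\<lambda>_. True) (Some j) (dup j ?F, \<lambda>_. 0) D"
    using z by (auto simp: zone_iff init_state_def)
  then show ?thesis
  proof cases
    case (step \<delta> E s' D')
    have "step ?B (with_dur v d) (dup j ?F, \<lambda>_. 0) (\<delta>, E) s'" by fact
    then obtain g a R L where E: "(dup j ?F, g, a, R, L) \<in> edges ?B"
      and dl: "delay_ok ?B (with_dur v d) (dup j ?F) 0 \<delta> g"
      unfolding step_delay_ok[OF x] by blast
    from E have "j = ?F" "g = [(x, Eq, dur)]"
      by (auto simp: reset_free_edges_iff dup_def split: if_splits)
    then show ?thesis using dl by (simp add: delay_ok_def)
  qed simp
qed

lemma word_zone_from_final: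
  fixes A :: "('a, 'l, 'x, 'p::finite) pta"
  assumes x: "(UNIV :: 'x set) = {x}"
    and "nfa_path (nfa_trans (zone_automaton A x)) i u k" "i = final_loc A" "(v, d) \<in> word_zone u"
  shows "d = 0"
  using assms(2-)
proof (induction arbitrary: d rule: nfa_path.induct)
  case (nfa_cons i S j u k)
  then obtain d1 d2 where d: "d = d1 + d2" "(v, d1) \<in> zone A x (final_loc A) j"
    "(v, d2) \<in> word_zone u"
    by (auto simp: zone_automaton_trans)
  with zone_from_final[OF x d(2)] nfa_cons.IH show ?case by simp
qed simp

lemma PET_word_zone:
  fixes A :: "('a, 'l, 'x, 'p::finite) pta"
  assumes x: "(UNIV :: 'x set) = {x}"
    and final_inv: "reset_into A (final_loc A) \<Longrightarrow> sat (\<lambda>p. real (v p)) (\<lambda>_. 0) (inv A (final_loc A))"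
  shows "(v, D) \<in> PET A \<longleftrightarrow> (\<exists>u. accepted_from A x (init_loc A) u \<and> (v, D) \<in> word_zone u)"
proof (cases "init_loc A = final_loc A")
  case True
  have "(v, D) \<in> PET A \<longleftrightarrow> D = 0"
    unfolding PET_iff init_state_def True by (auto elim: run_to.cases intro: run_to.stop)
  moreover have "accepted_from A x (final_loc A) []" "(v, 0) \<in> word_zone []"
    by (auto intro: nfa_nil)
  ultimately show ?thesis unfolding True using word_zone_from_final[OF x _ refl, where A = A and v = v and d = D]
    by blast
next
  case False
  show ?thesis
  proof
    assume "(v, D) \<in> PET A"
    then obtain j d u D' where *: "segment A (\<lambda>p. real (v p)) j (init_loc A) 0 d"
      "accepted_from A x j u" "(v, D') \<in> word_zone u" "D = d + D'"
      using reaches_final_segment[OF x _ False order_refl] by (fastforce simp: PET_iff init_state_def)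
    from segment_props[OF *(1)] have "(init_loc A, j) \<in> FrP A" by (auto simp: FrP_def)
    with *(2) have "accepted_from A x (init_loc A) (zone A x (init_loc A) j # u)"
      by (auto intro: nfa_cons simp: zone_automaton_trans)
    moreover have "(v, D) \<in> word_zone (zone A x (init_loc A) j # u)"
      using * zone_segment[OF x False] by auto
    ultimately show "\<exists>u. accepted_from A x (init_loc A) u \<and> (v, D) \<in> word_zone u" by blast
  next
    assume "\<exists>u. accepted_from A x (init_loc A) u \<and> (v, D) \<in> word_zone u"
    then show "(v, D) \<in> PET A"
      using word_zone_reaches_final[OF x False final_inv _ False]
      by (auto simp: PET_iff init_state_def)
  qed
qed

lemma nfa_path_letters:
  assumes "nfa_path T q u q'" "b \<in> set u"
  shows "\<exists>i j. (i, b, j) \<in> T"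
  using assms by induction auto

theorem proposition4:
  fixes A :: "('a::finite, 'l::finite, 'x::finite, 'p::finite) pta"
    and x :: 'x
    and e :: "(('p \<Rightarrow> nat) \<times> real) set rexp"
    and rep :: "(('p \<Rightarrow> nat) \<times> real) set \<Rightarrow> 'p polys"
  assumes "finite (edges A)"
    and one_clock: "(UNIV :: 'x set) = {x}"
    and final_inv: "\<And>v :: 'p \<Rightarrow> nat. reset_into A (final_loc A) \<Longrightarrow>
      sat (\<lambda>p. real (v p)) (\<lambda>_. 0) (inv A (final_loc A))"
    and rep: "\<And>i j. (i, j) \<in> FrP A \<Longrightarrow> represents (rep (zone A x i j)) (zone A x i j)"
    and e: "lang e = nfa_lang (zone_automaton A x)"
  shows "polys_sem (zone_expr rep e) = PET A"
proof -
  have lang: "lang e = {u. accepted_from A x (init_loc A) u}"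
    unfolding e by (simp add: nfa_lang_def zone_automaton_def)
  \<comment> \<open>A letter of an accepted word labels a transition, hence is the zone of a
    final-reset pair, which is where \<open>rep\<close> is assumed to be correct.\<close>
  have "represents (rep b) b" if "u \<in> lang e" "b \<in> set u" for u b
    using that nfa_path_letters[of _ _ u _ b] rep unfolding lang
    by (fastforce simp: zone_automaton_trans)
  then have "polys_sem (zone_expr rep e) = (\<Union>u\<in>lang e. word_zone u)"
    by (rule polys_sem_zone_expr)
  moreover have "(v, D) \<in> PET A \<longleftrightarrow> (\<exists>u\<in>lang e. (v, D) \<in> word_zone u)" for v D
    unfolding lang using PET_word_zone[OF one_clock final_inv] by simp
  ultimately show ?thesis by auto
qed

end
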